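(* $\mathbf{Sym}^{(\ell)}$ is free (as an associative algebra) over the set $\{S_{\mathbf{n}} : \mathbf{n}\in\mathbb{N}^\ell,\ |\mathbf{n}|>0\}$, so that a linear basis is given by the elements $$S^{\mathbf{I}}=S_{\mathbf{i}_1}\cdots S_{\mathbf{i}_m},$$ where $\mathbf{I}$ runs over all vector compositions and $\mathbf{i}_1,\ldots,\mathbf{i}_m$ are the columns of $\mathbf{I}$. Moreover, $\mathbf{Sym}^{(\ell)}$ is a Hopf subalgebra of $\mathbf{FQSym}^{(\ell)}$, and the coproduct of the generators is given by $$\Delta S_{\mathbf{n}}=\sum_{\mathbf{i}+\mathbf{j}=\mathbf{n}}S_{\mathbf{i}}\otimes S_{\mathbf{j}},$$ where the sum $\mathbf{i}+\mathbf{j}$ is taken in $\mathbb{N}^\ell$. In particular, $\mathbf{Sym}^{(\ell)}$ is cocommutative.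
   Context: Let $C$ be a set of $\ell$ colors. A colored permutation of size $n$ is a pair $(\sigma,u)$ with $\sigma\in\mathfrak{S}_n$, $u\in C^n$. $\mathbf{FQSym}^{(\ell)}$ is the graded connected Hopf algebra with basis $\mathbf{G}_{\sigma,u}$ indexed by colored permutations, with $$\mathbf{G}_{\sigma',u'}\mathbf{G}_{\sigma'',u''}=\sum_{\sigma\in\sigma'*\sigma''}\mathbf{G}_{\sigma,u'\cdot u''},\qquad \Delta\mathbf{G}_{\sigma,u}=\sum_{(\sigma,u)\in(\sigma',u')\Cup(\sigma'',u'')}\mathbf{G}_{\sigma',u'}\otimes\mathbf{G}_{\sigma'',u''}.$$ Here $\sigma'*\sigma''$ (convolution, $\sigma'\in\mathfrak S_p$, $\sigma''\in\mathfrak S_q$) is the set of $\tau\in\mathfrak{S}_{p+q}$ such that the standardizations of the words formed by the first $p$ and the last $q$ letters of $\tau$ are $\sigma'$ and $\sigma''$ (the standardization of a word is the permutation with the same inversions); $u'\cdot u''$ is concatenation; and $(\sigma',u')\Cup(\sigma'',u'')$ is the shifted shuffle, i.e. the shuffle of the words of biletters $(\sigma',u')$ and $(\sigma''[p],u'')$, where $\sigma''[p]$ is $\sigma''$ with $p=|\sigma'|$ added to each letter (colors follow their letters). $\mathbf{G}$ indexed by the empty colored permutation is $1$. An $\ell$-partite number is a vector $\mathbf{n}=(n_i)_{i\in C}\in\mathbb{N}^\ell$, of weight $|\mathbf{n}|=\sum_i n_i$. A vector composition is a matrix $\mathbf{I}$ of nonnegative integers with $\ell$ rows, with any finite number $m\ge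 0$ of columns and with no zero column. For $\mathbf{n}\in\mathbb{N}^\ell$ with $|\mathbf{n}|=n$, $$S_{\mathbf{n}}=\sum_{u\in C^n;\ |u|_i=n_i\ \forall i}\mathbf{G}_{12\cdots n,\,u},\qquad S_{\mathbf{0}}=1,$$ where $|u|_i$ is the number of occurrences of color $i$ in $u$. $\mathbf{Sym}^{(\ell)}$ is the subalgebra of $\mathbf{FQSym}^{(\ell)}$ generated by all the $S_{\mathbf{n}}$. *)

theory Defs
  imports "HOL-Analysis.Finite_Cartesian_Product" "HOL-Library.Poly_Mapping"
begin

section \<open>Vector spaces with a given basis\<close>

text \<open>\<open>'a \<Rightarrow>\<^sub>0 'k\<close> is the \<open>'k\<close>-vector space with basis \<open>'a\<close>; the basis vector of \<open>a\<close> is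
  \<open>Poly_Mapping.single a 1\<close>.\<close>

definition scale :: "'k::field \<Rightarrow> ('a \<Rightarrow>\<^sub>0 'k) \<Rightarrow> ('a \<Rightarrow>\<^sub>0 'k)" where
  "scale c x = Poly_Mapping.map ((*) c) x"

lemma lookup_scale [simp]: "Poly_Mapping.lookup (scale c x) a = c * Poly_Mapping.lookup x a"
  by (simp add: scale_def Poly_Mapping.map.rep_eq when_def)

global_interpretation pm: vector_space "scale :: 'k::field \<Rightarrow> ('a \<Rightarrow>\<^sub>0 'k) \<Rightarrow> ('a \<Rightarrow>\<^sub>0 'k)"
  by unfold_locales (auto intro!: poly_mapping_eqI simp: lookup_add algebra_simps)

text \<open>The tensor product of the spaces with bases \<open>'a\<close> and \<open>'b\<close> is the space with basis \<open>'a \<times> 'b\<close>.\<close>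

definition tensor :: "('a \<Rightarrow>\<^sub>0 'k::field) \<Rightarrow> ('b \<Rightarrow>\<^sub>0 'k) \<Rightarrow> ('a \<times> 'b \<Rightarrow>\<^sub>0 'k)"  (infixr \<open>\<otimes>\<^sub>t\<close> 72) where
  "x \<otimes>\<^sub>t y = (\<Sum>a\<in>Poly_Mapping.keys x. \<Sum>b\<in>Poly_Mapping.keys y.
     Poly_Mapping.single (a, b) (Poly_Mapping.lookup x a * Poly_Mapping.lookup y b))"

definition tensor_subspace :: "('a \<Rightarrow>\<^sub>0 'k::field) set \<Rightarrow> ('b \<Rightarrow>\<^sub>0 'k) set \<Rightarrow> ('a \<times> 'b \<Rightarrow>\<^sub>0 'k) set" where
  "tensor_subspace A B = pm.span {x \<otimes>\<^sub>t y |x y. x \<in> A \<and> y \<in> B}"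

definition twist :: "('a \<times> 'b \<Rightarrow>\<^sub>0 'k::field) \<Rightarrow> ('b \<times> 'a \<Rightarrow>\<^sub>0 'k)" where
  "twist t = Poly_Mapping.map_key prod.swap t"


section \<open>Colored permutations\<close>

text \<open>A permutation of size \<open>n\<close> is written as the word of its values, a list of the letters
  \<open>1, \<dots>, n\<close>.\<close>

definition is_perm :: "nat list \<Rightarrow> bool" where
  "is_perm s \<longleftrightarrow> distinct s \<and> set s = {1..length s}"

typedef 'c cperm = "{(s :: nat list, u :: 'c list). is_perm s \<and> length u = length s}"
  morphisms rep_cperm Abs_cperm
  by (rule exI[of _ "([], [])"]) (simp add: is_perm_def)

setup_lifting type_definition_cperm

lift_definition cp_word :: "'c cperm \<Rightarrow> nat list" is fst .
lift_definition cp_colors :: "'c cperm \<Rightarrow> 'c list" is snd .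
lift_definition cp_empty :: "'c cperm" is "([], [])" by (simp add: is_perm_def)

definition cp_size :: "'c cperm \<Rightarrow> nat" where
  "cp_size a = length (cp_word a)"

text \<open>\<open>s\<close> is the standardization of the word \<open>w\<close>.\<close>

definition is_std :: "nat list \<Rightarrow> nat list \<Rightarrow> bool" where
  "is_std s w \<longleftrightarrow> is_perm s \<and> length s = length w \<and>
     (\<forall>i j. i < j \<and> j < length w \<longrightarrow> (s ! i > s ! j \<longleftrightarrow> w ! i > w ! j))"

definition convolution :: "nat list \<Rightarrow> nat list \<Rightarrow> nat list set" where
  "convolution s' s'' = {t. is_perm t \<and> length t = length s' + length s'' \<and>
     is_std s' (take (length s') t) \<and> is_std s'' (drop (length s') t)}"

definition cp_convolution :: "'c cperm \<Rightarrow> 'c cperm \<Rightarrow> 'c cperm set" where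
  "cp_convolution a b = {c. cp_word c \<in> convolution (cp_word a) (cp_word b) \<and>
     cp_colors c = cp_colors a @ cp_colors b}"

definition biletters :: "'c cperm \<Rightarrow> (nat \<times> 'c) list" where
  "biletters a = zip (cp_word a) (cp_colors a)"

definition shifted_shuffle :: "'c cperm \<Rightarrow> 'c cperm \<Rightarrow> 'c cperm set" where
  "shifted_shuffle a b = {c. biletters c \<in>
     shuffles (biletters a) (map (\<lambda>(x, k). (x + cp_size a, k)) (biletters b))}"

lemma length_cp_colors: "length (cp_colors a) = length (cp_word a)"
  by transfer auto

lemma is_perm_cp_word: "is_perm (cp_word a)"
  by transfer auto

lemma cperm_eqI: "cp_word a = cp_word b \<Longrightarrow> cp_colors a = cp_colors b \<Longrightarrow> a = b"
  by transfer auto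

lemma finite_cperm_of_size: "finite {c :: 'c::finite cperm. cp_size c \<le> n}"
proof (rule finite_subset)
  let ?A = "{s. set s \<subseteq> {1..n} \<and> length s \<le> n}" and ?B = "{u :: 'c list. set u \<subseteq> UNIV \<and> length u \<le> n}"
  show "{c :: 'c cperm. cp_size c \<le> n} \<subseteq> (\<lambda>c. (cp_word c, cp_colors c)) -` (?A \<times> ?B)"
    using is_perm_cp_word by (fastforce simp: cp_size_def length_cp_colors is_perm_def)
  show "finite ((\<lambda>c :: 'c cperm. (cp_word c, cp_colors c)) -` (?A \<times> ?B))"
    by (intro finite_vimageI finite_cartesian_product finite_lists_length_le)
       (auto intro!: injI cperm_eqI)
qed

lemma finite_cp_convolution: "finite (cp_convolution a (b :: 'c::finite cperm))"
  by (rule finite_subset[OF _ finite_cperm_of_size[of "cp_size a + cp_size b"]])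
     (auto simp: cp_convolution_def convolution_def cp_size_def)

lemma finite_unshuffles: "finite {(a, b). (c :: 'c::finite cperm) \<in> shifted_shuffle a b}"
  by (rule finite_subset[OF _ finite_cartesian_product[OF
        finite_cperm_of_size[of "cp_size c"] finite_cperm_of_size[of "cp_size c"]]])
     (auto simp: shifted_shuffle_def biletters_def cp_size_def length_cp_colors dest: length_shuffles)


section \<open>The Hopf algebra of colored free quasi-symmetric functions\<close>

text \<open>The set of colors is a finite type \<open>'c\<close>, so \<open>\<ell> = CARD('c)\<close>; the ground field is \<open>'k\<close>. The
  basis element \<open>fq_G a\<close> is the basis vector of the colored permutation \<open>a\<close>.\<close>

type_synonym ('c, 'k) fqsym = "'c cperm \<Rightarrow>\<^sub>0 'k"

definition fq_G :: "'c cperm \<Rightarrow> ('c, 'k::field) fqsym" where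
  "fq_G a = Poly_Mapping.single a 1"

definition fq_one :: "('c, 'k::field) fqsym" where
  "fq_one = fq_G cp_empty"

definition fq_mult :: "('c::finite, 'k::field) fqsym \<Rightarrow> ('c, 'k) fqsym \<Rightarrow> ('c, 'k) fqsym"
    (infixl \<open>\<bullet>\<^sub>F\<close> 75) where
  "x \<bullet>\<^sub>F y = (\<Sum>a\<in>Poly_Mapping.keys x. \<Sum>b\<in>Poly_Mapping.keys y.
     scale (Poly_Mapping.lookup x a * Poly_Mapping.lookup y b) (\<Sum>c\<in>cp_convolution a b. fq_G c))"

definition coproduct :: "('c::finite, 'k::field) fqsym \<Rightarrow> ('c cperm \<times> 'c cperm \<Rightarrow>\<^sub>0 'k)" where
  "coproduct x = (\<Sum>c\<in>Poly_Mapping.keys x. scale (Poly_Mapping.lookup x c)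
     (\<Sum>(a, b)\<in>{(a, b). c \<in> shifted_shuffle a b}. fq_G a \<otimes>\<^sub>t fq_G b))"

text \<open>As the algebra is graded and connected, its counit is the projection onto degree \<open>0\<close>.\<close>

definition counit :: "('c, 'k::field) fqsym \<Rightarrow> 'k" where
  "counit x = Poly_Mapping.lookup x cp_empty"

text \<open>The convolution product \<open>\<mu> \<circ> (f \<otimes> g) \<circ> \<Delta>\<close> of two linear endomorphisms.\<close>

definition endo_convolution :: "(('c::finite, 'k::field) fqsym \<Rightarrow> ('c, 'k) fqsym) \<Rightarrow>
    (('c, 'k) fqsym \<Rightarrow> ('c, 'k) fqsym) \<Rightarrow> ('c, 'k) fqsym \<Rightarrow> ('c, 'k) fqsym" where
  "endo_convolution f g x = (\<Sum>(a, b)\<in>Poly_Mapping.keys (coproduct x).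
     scale (Poly_Mapping.lookup (coproduct x) (a, b)) (f (fq_G a) \<bullet>\<^sub>F g (fq_G b)))"

definition is_antipode :: "(('c::finite, 'k::field) fqsym \<Rightarrow> ('c, 'k) fqsym) \<Rightarrow> bool" where
  "is_antipode T \<longleftrightarrow> Vector_Spaces.linear scale scale T \<and>
     (\<forall>x. endo_convolution T id x = scale (counit x) fq_one \<and>
          endo_convolution id T x = scale (counit x) fq_one)"

definition subalgebra :: "('c::finite, 'k::field) fqsym set \<Rightarrow> bool" where
  "subalgebra A \<longleftrightarrow> pm.subspace A \<and> fq_one \<in> A \<and> (\<forall>x\<in>A. \<forall>y\<in>A. x \<bullet>\<^sub>F y \<in> A)"

text \<open>An antipode is unique if it exists, so the last clause says that the ambient algebra has
  an antipode and that this antipode maps \<open>A\<close> into \<open>A\<close>.\<close>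

definition hopf_subalgebra :: "('c::finite, 'k::field) fqsym set \<Rightarrow> bool" where
  "hopf_subalgebra A \<longleftrightarrow> subalgebra A \<and>
     (\<forall>x\<in>A. coproduct x \<in> tensor_subspace A A) \<and>
     (\<exists>T. is_antipode T \<and> (\<forall>x\<in>A. T x \<in> A))"

definition cocommutative_on :: "('c::finite, 'k::field) fqsym set \<Rightarrow> bool" where
  "cocommutative_on A \<longleftrightarrow> (\<forall>x\<in>A. twist (coproduct x) = coproduct x)"


section \<open>Free associative algebras\<close>

text \<open>Words form a monoid under concatenation, written additively so that \<open>'x list \<Rightarrow>\<^sub>0 'k\<close> with the
  multiplication of the library is the algebra of noncommutative polynomials on \<open>'x\<close>.\<close>

instantiation list :: (type) monoid_add
begin
definition zero_list :: "'a list" where "zero_list = []"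
definition plus_list :: "'a list \<Rightarrow> 'a list \<Rightarrow> 'a list" where "plus_list xs ys = xs @ ys"
instance by standard (simp_all add: zero_list_def plus_list_def)
end

definition free_algebra :: "'x set \<Rightarrow> ('x list \<Rightarrow>\<^sub>0 'k::field) set" where
  "free_algebra X = {p. Poly_Mapping.keys p \<subseteq> lists X}"

text \<open>\<open>A\<close> is free over its subset \<open>X\<close>: there is an algebra isomorphism from the free algebra on the
  alphabet \<open>X\<close> onto \<open>A\<close> sending each letter to itself.\<close>

definition free_over :: "('c::finite, 'k::field) fqsym set \<Rightarrow> ('c, 'k) fqsym set \<Rightarrow> bool" where
  "free_over A X \<longleftrightarrow> subalgebra A \<and> (\<exists>\<phi> :: (('c, 'k) fqsym list \<Rightarrow>\<^sub>0 'k) \<Rightarrow> ('c, 'k) fqsym.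
     bij_betw \<phi> (free_algebra X) A \<and>
     (\<forall>p\<in>free_algebra X. \<forall>q\<in>free_algebra X. \<phi> (p + q) = \<phi> p + \<phi> q) \<and>
     (\<forall>c. \<forall>p\<in>free_algebra X. \<phi> (scale c p) = scale c (\<phi> p)) \<and>
     \<phi> 1 = fq_one \<and>
     (\<forall>p\<in>free_algebra X. \<forall>q\<in>free_algebra X. \<phi> (p * q) = \<phi> p \<bullet>\<^sub>F \<phi> q) \<and>
     (\<forall>x\<in>X. \<phi> (Poly_Mapping.single [x] 1) = x))"


section \<open>Noncommutative multi-symmetric functions\<close>

definition weight :: "nat ^ 'c::finite \<Rightarrow> nat" where
  "weight n = (\<Sum>i\<in>UNIV. n $ i)"

text \<open>A vector composition is given as the list of its columns.\<close>

definition vector_compositions :: "(nat ^ 'c::finite) list set" where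
  "vector_compositions = {I. 0 \<notin> set I}"

definition fq_S :: "nat ^ 'c::finite \<Rightarrow> ('c, 'k::field) fqsym" where
  "fq_S n = (\<Sum>a\<in>{a. cp_word a = [1..<Suc (weight n)] \<and> (\<forall>i. count_list (cp_colors a) i = n $ i)}. fq_G a)"

definition fq_S_comp :: "(nat ^ 'c::finite) list \<Rightarrow> ('c, 'k::field) fqsym" where
  "fq_S_comp I = foldr (\<lambda>n x. fq_S n \<bullet>\<^sub>F x) I fq_one"

definition Sym :: "('c::finite, 'k::field) fqsym set" where
  "Sym = subalgebra hull (range fq_S)"

lemma finite_fq_S_index:
  "finite {a :: 'c::finite cperm. cp_word a = [1..<Suc (weight n)] \<and> (\<forall>i. count_list (cp_colors a) i = n $ i)}"
  by (rule finite_subset[OF _ finite_cperm_of_size[of "weight n"]]) (auto simp: cp_size_def)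

lemma fq_S_zero: "fq_S 0 = (fq_one :: ('c::finite, 'k::field) fqsym)"
proof -
  have "{a :: 'c cperm. cp_word a = [1..<Suc (weight (0 :: nat ^ 'c))] \<and>
      (\<forall>i. count_list (cp_colors a) i = (0 :: nat ^ 'c) $ i)} = {cp_empty}"
    by (auto simp: weight_def cp_empty.rep_eq cp_word.rep_eq cp_colors.rep_eq
        intro!: cperm_eqI) (metis length_cp_colors cp_colors.rep_eq cp_word.rep_eq length_0_conv)
  then show ?thesis by (simp add: fq_S_def fq_one_def)
qed

lemma finite_sum_decompositions: "finite {(i, j). i + j = (n :: nat ^ 'c::finite)}"
proof -
  have "finite {f :: 'c \<Rightarrow> nat. \<forall>k. f k \<le> n $ k}"
    using finite_PiE[of "UNIV :: 'c set" "\<lambda>k. {..n $ k}"] by (simp add: PiE_def Pi_def)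
  then have "finite (vec_nth -` {f :: 'c \<Rightarrow> nat. \<forall>k. f k \<le> n $ k})"
    by (rule finite_vimageI) (auto intro!: injI simp: vec_eq_iff)
  from finite_cartesian_product[OF this this] show ?thesis
    by (rule rev_finite_subset) auto
qed

end

theory Submission
  imports Defs
begin

text \<open>The coefficient of the basis element of \<open>(\<sigma>, u)\<close> in \<open>S\<^sup>I\<close> is 1 if its word of biletters splits into
  consecutive increasing blocks whose color contents are the columns of \<open>I\<close>, and 0 otherwise.
  Independence follows by evaluating at the words whose descents are exactly the block boundaries.
  Cutting each block of a shuffle into its small and its large letters gives
  \<open>\<Delta> S\<^sup>I = \<Sum> S\<^sup>J \<otimes> S\<^sup>K\<close> over all \<open>J + K = I\<close>, where \<open>J\<close> and \<open>K\<close> may have zero columns. The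
  antipode exists because the left and the right inverse of the identity under convolution can be
  defined by recursion on the degree; it preserves the subalgebra by induction on the degree of \<open>S\<^sup>I\<close>.\<close>

section \<open>Linear extension\<close>

text \<open>Both operations rest on unique cuts. For every position \<open>p\<close> there is
  exactly one way to see a colored permutation in a product of two basis elements: cut its word
  after \<open>p\<close> letters and standardize. For every value \<open>p\<close> there is exactly
  one way to see it in a shifted shuffle: separate the letters \<open>\<le> p\<close> from the
  larger ones. Product coefficients and coproducts thus become sums over one integer, and the
  associativity of the product and of the convolution of endomorphisms come down to the same
  exchange of two cuts. The coefficients of the coproduct of \<open>S\<^sup>I\<close> can exceed 1,
  so the two sides are compared by counting in the natural numbers before passing to the field. A
  zero column in \<open>J\<close> or \<open>K\<close> records that a block has no small or no large
  letters; it does no harm because its factor is the unit.\<close>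

definition lin_ext :: "('a \<Rightarrow> 'b \<Rightarrow>\<^sub>0 'k::field) \<Rightarrow> ('a \<Rightarrow>\<^sub>0 'k) \<Rightarrow> ('b \<Rightarrow>\<^sub>0 'k)" where
  "lin_ext f x = (\<Sum>a\<in>Poly_Mapping.keys x. scale (Poly_Mapping.lookup x a) (f a))"

text \<open>Cancellation can shrink the keys of a sum, and a zero scalar those of a multiple, so
  linearity is checked over one common finite index set on which the missing terms vanish.\<close>

lemma lin_ext_superset:
  assumes "finite A" "Poly_Mapping.keys x \<subseteq> A"
  shows "lin_ext f x = (\<Sum>a\<in>A. scale (Poly_Mapping.lookup x a) (f a))"
  unfolding lin_ext_def using assms
  by (intro sum.mono_neutral_left) (auto simp: in_keys_iff)

lemma lin_ext_add: "lin_ext f (x + y) = lin_ext f x + lin_ext f y"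
proof -
  let ?A = "Poly_Mapping.keys x \<union> Poly_Mapping.keys y"
  have "Poly_Mapping.keys (x + y) \<subseteq> ?A" by (rule Poly_Mapping.keys_add)
  then show ?thesis
    by (simp add: lin_ext_superset[of ?A] lookup_add pm.scale_left_distrib sum.distrib)
qed

lemma lin_ext_scale: "lin_ext f (scale c x) = scale c (lin_ext f x)"
proof -
  have "Poly_Mapping.keys (scale c x) \<subseteq> Poly_Mapping.keys x"
    by (auto simp: in_keys_iff)
  then show ?thesis
    by (simp add: lin_ext_superset[of "Poly_Mapping.keys x"] pm.scale_sum_right)
qed

lemma lin_ext_zero [simp]: "lin_ext f 0 = 0"
  by (simp add: lin_ext_def)

lemma lin_ext_sum: "lin_ext f (\<Sum>i\<in>A. g i) = (\<Sum>i\<in>A. lin_ext f (g i))"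
  by (induction A rule: infinite_finite_induct) (simp_all add: lin_ext_add)

lemma lin_ext_single: "lin_ext f (Poly_Mapping.single a c) = scale c (f a)"
  by (simp add: lin_ext_superset[of "{a}"])

lemma lin_ext_lin_ext: "lin_ext f (lin_ext g x) = lin_ext (\<lambda>a. lin_ext f (g a)) x"
  by (simp add: lin_ext_def[of g] lin_ext_sum lin_ext_scale) (simp add: lin_ext_def)

lemma lin_ext_cong:
  "(\<And>a. a \<in> Poly_Mapping.keys x \<Longrightarrow> f a = g a) \<Longrightarrow> lin_ext f x = lin_ext g x"
  by (simp add: lin_ext_def)

lemma lin_ext_basis [simp]: "lin_ext (\<lambda>a. Poly_Mapping.single a 1) x = x"
  by (rule poly_mapping_eqI)
     (auto simp: lin_ext_def lookup_sum lookup_single when_def if_distrib sum.delta in_keys_iff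
       cong: if_cong)

lemma lookup_lin_ext:
  "Poly_Mapping.lookup (lin_ext f x) b =
     (\<Sum>a\<in>Poly_Mapping.keys x. Poly_Mapping.lookup x a * Poly_Mapping.lookup (f a) b)"
  by (simp add: lin_ext_def lookup_sum)

lemma lin_ext_diff: "lin_ext f (x - y) = lin_ext f x - lin_ext f y"
  using lin_ext_add[of f "x - y" y] by simp

lemma linear_lin_ext: "Vector_Spaces.linear scale scale (lin_ext f)"
  by (simp add: Vector_Spaces.linear_iff pm.vector_space_axioms lin_ext_add lin_ext_scale)

lemma lookup_tensor [simp]:
  "Poly_Mapping.lookup (x \<otimes>\<^sub>t y) (a, b) = Poly_Mapping.lookup x a * Poly_Mapping.lookup y b"
proof -
  have "Poly_Mapping.lookup (x \<otimes>\<^sub>t y) (a, b) =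
     (\<Sum>a'\<in>Poly_Mapping.keys x. \<Sum>b'\<in>Poly_Mapping.keys y.
       if a' = a then if b' = b then Poly_Mapping.lookup x a' * Poly_Mapping.lookup y b' else 0 else 0)"
    unfolding tensor_def lookup_sum
    by (intro sum.cong refl) (auto simp: lookup_single when_def)
  also have "\<dots> = (\<Sum>a'\<in>Poly_Mapping.keys x. if a' = a then
      (\<Sum>b'\<in>Poly_Mapping.keys y. if b' = b then Poly_Mapping.lookup x a' * Poly_Mapping.lookup y b' else 0) else 0)"
    by (intro sum.cong refl) auto
  also have "\<dots> = Poly_Mapping.lookup x a * Poly_Mapping.lookup y b"
    by (auto simp: in_keys_iff)
  finally show ?thesis .
qed

lemma tensor_fq_G: "fq_G a \<otimes>\<^sub>t fq_G b = Poly_Mapping.single (a, b) 1"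
  by (rule poly_mapping_eqI) (auto simp: fq_G_def lookup_single when_def split: if_splits)

section \<open>Standardization of words of biletters\<close>

text \<open>On a finite set \<open>A\<close> this restricts to the increasing bijection from
  \<open>A\<close> onto \<open>{1..card A}\<close>, so replacing letters by ranks standardizes a
  word.\<close>

definition rank :: "nat set \<Rightarrow> nat \<Rightarrow> nat" where
  "rank A x = card {y \<in> A. y \<le> x}"

abbreviation relabel :: "(nat \<Rightarrow> nat) \<Rightarrow> (nat \<times> 'c) list \<Rightarrow> (nat \<times> 'c) list" where
  "relabel f \<equiv> map (map_prod f id)"

text \<open>A formula in place of the characterization by inversions; \<open>is_std_iff\<close>
  identifies the two for distinct letters.\<close>

definition stdb :: "(nat \<times> 'c) list \<Rightarrow> (nat \<times> 'c) list" where
  "stdb w = relabel (rank (fst ` set w)) w"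

lemma rank_less: "finite A \<Longrightarrow> y \<in> A \<Longrightarrow> x < y \<Longrightarrow> rank A x < rank A y"
  unfolding rank_def by (rule psubset_card_mono) (auto dest: le_less_trans)

lemma strict_mono_on_rank: "finite A \<Longrightarrow> strict_mono_on A (rank A)"
  by (auto simp: strict_mono_on_def rank_less)

lemma rank_image:
  assumes "strict_mono_on A f" "x \<in> A"
  shows "rank (f ` A) (f x) = rank A x"
proof -
  have "{y \<in> f ` A. y \<le> f x} = f ` {y \<in> A. y \<le> x}"
    using assms by (auto simp: strict_mono_on_less_eq)
  moreover have "inj_on f {y \<in> A. y \<le> x}"
    using strict_mono_on_imp_inj_on[OF assms(1)] by (rule inj_on_subset) auto
  ultimately show ?thesis by (simp add: rank_def card_image)
qed

lemma rank_atLeastAtMost: "x \<in> {1..n} \<Longrightarrow> rank {1..n} x = x"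
proof -
  assume "x \<in> {1..n}"
  then have "{y \<in> {1..n}. y \<le> x} = {1..x}" by auto
  then show ?thesis by (simp add: rank_def)
qed

text \<open>Ranks see only the relative order of the letters. This is why standardizing a whole word
  does not affect the standardization of its prefixes and suffixes.\<close>

lemma stdb_relabel:
  assumes "strict_mono_on (fst ` set w) f"
  shows "stdb (relabel f w) = stdb w"
proof -
  have "fst ` set (relabel f w) = f ` fst ` set w"
    by (simp add: image_image)
  then show ?thesis
    unfolding stdb_def map_map
    by (intro map_cong refl) (simp add: prod_eq_iff rank_image[OF assms])
qed

lemma map_fst_relabel [simp]: "map fst (relabel f w) = map f (map fst w)"
  and map_snd_relabel [simp]: "map snd (relabel f w) = map snd w"
  by auto

lemma length_stdb [simp]: "length (stdb w) = length w"
  and map_snd_stdb [simp]: "map snd (stdb w) = map snd w"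
  by (simp_all add: stdb_def)

lemma map_fst_stdb: "map fst (stdb w) = map (rank (set (map fst w))) (map fst w)"
  by (simp add: stdb_def)

text \<open>The ranks of the letters are distinct and lie between 1 and the length, so by
  cardinality they exhaust that interval.\<close>

lemma is_perm_stdb: "distinct (map fst w) \<Longrightarrow> is_perm (map fst (stdb w))"
proof -
  assume d: "distinct (map fst w)"
  let ?A = "fst ` set w"
  have inj: "inj_on (rank ?A) ?A"
    by (intro strict_mono_on_imp_inj_on strict_mono_on_rank) simp
  have c: "card ?A = length w"
    using distinct_card[OF d] by simp
  have "rank ?A ` ?A \<subseteq> {1..length w}"
  proof safe
    fix x k assume "(x, k) \<in> set w"
    then have "rank ?A x > 0" unfolding rank_def by (subst card_gt_0_iff) force
    moreover have "rank ?A x \<le> length w"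
      unfolding rank_def c[symmetric] by (rule card_mono) auto
    ultimately show "rank ?A (fst (x, k)) \<in> {1..length w}" by simp
  qed
  then have "rank ?A ` ?A = {1..length w}"
    using inj c by (intro card_subset_eq) (simp_all add: card_image)
  then show ?thesis
    using d inj by (simp add: is_perm_def stdb_def distinct_map image_image o_def map_prod_def)
      (auto simp: distinct_map comp_inj_on_iff o_def case_prod_unfold)
qed

lemma stdb_is_perm: "is_perm (map fst w) \<Longrightarrow> stdb w = w"
proof -
  assume "is_perm (map fst w)"
  then have "fst ` set w = {1..length w}" by (simp add: is_perm_def)
  then show ?thesis unfolding stdb_def
    by (intro map_idI) (metis rank_atLeastAtMost fst_map_prod snd_map_prod id_apply image_eqI prod.expand)
qed

lemma stdb_stdb_take: "stdb (take p (stdb w)) = stdb (take p w)"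
  unfolding stdb_def[of w] take_map
  by (rule stdb_relabel) (rule monotone_on_subset[OF strict_mono_on_rank], auto dest: in_set_takeD)

lemma stdb_stdb_drop: "stdb (drop p (stdb w)) = stdb (drop p w)"
  unfolding stdb_def[of w] drop_map
  by (rule stdb_relabel) (rule monotone_on_subset[OF strict_mono_on_rank], auto dest: in_set_dropD)

text \<open>With distinct letters, equal inversions mean that any two positions compare alike in
  \<open>s\<close> and \<open>w\<close>. So corresponding letters have equal ranks, and the letters
  of the permutation \<open>s\<close> are their own ranks.\<close>

lemma is_std_iff:
  assumes "distinct w"
  shows "is_std s w \<longleftrightarrow> s = map (rank (set w)) w"
proof
  assume "is_std s w"
  then have s: "distinct s" "set s = {1..length s}" and len: "length s = length w"
    and inv: "\<And>i j. i < j \<Longrightarrow> j < length w \<Longrightarrow> s ! i > s ! j \<longleftrightarrow> w ! i > w ! j"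
    by (auto simp: is_std_def is_perm_def)
  have le: "s ! i \<le> s ! j \<longleftrightarrow> w ! i \<le> w ! j" if "i < length w" "j < length w" for i j
  proof (cases i j rule: linorder_cases)
    case less then show ?thesis using inv[of i j] that by auto
  next
    case greater
    then have "s ! i \<noteq> s ! j" "w ! i \<noteq> w ! j"
      using that assms s(1) len by (auto simp: nth_eq_iff_index_eq)
    then show ?thesis using inv[of j i] that greater by auto
  qed auto
  show "s = map (rank (set w)) w"
  proof (rule nth_equalityI)
    fix i assume "i < length s"
    then have i: "i < length w" using len by simp
    \<comment> \<open>For distinct letters the rank counts positions instead of values, and
      positions can be compared across \<open>s\<close> and \<open>w\<close>.\<close>
    have *: "rank (set v) (v ! i) = card {j. j < length v \<and> v ! j \<le> v ! i}" if "distinct v" for v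
    proof -
      have "{y \<in> set v. y \<le> v ! i} = (!) v ` {j. j < length v \<and> v ! j \<le> v ! i}"
        by (auto simp: set_conv_nth)
      moreover have "inj_on ((!) v) {j. j < length v \<and> v ! j \<le> v ! i}"
        using that by (auto simp: inj_on_def nth_eq_iff_index_eq)
      ultimately show ?thesis by (simp add: rank_def card_image)
    qed
    have "s ! i = rank (set s) (s ! i)"
      using s i len by (metis nth_mem rank_atLeastAtMost)
    also have "\<dots> = card {j. j < length w \<and> w ! j \<le> w ! i}"
      unfolding *[OF s(1)] using le i len by (intro arg_cong[where f = card]) auto
    finally show "s ! i = map (rank (set w)) w ! i"
      using i *[OF assms] by simp
  qed (simp add: len)
next
  assume s: "s = map (rank (set w)) w"
  \<comment> \<open>Dummy colors of type \<open>unit\<close> turn the uncolored word into a word of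
    biletters.\<close>
  have "is_perm s"
    using is_perm_stdb[of "map (\<lambda>x. (x, ())) w"] assms
    by (simp add: s stdb_def o_def image_image)
  moreover have "strict_mono_on (set w) (rank (set w))"
    by (simp add: strict_mono_on_rank)
  ultimately show "is_std s w"
    by (auto simp: is_std_def s strict_mono_on_less)
qed


section \<open>Colored permutations as words of biletters\<close>

definition of_bi :: "(nat \<times> 'c) list \<Rightarrow> 'c cperm" where
  "of_bi w = Abs_cperm (map fst w, map snd w)"

lemma biletters_of_bi: "is_perm (map fst w) \<Longrightarrow> biletters (of_bi w) = w"
  by (simp add: of_bi_def cp_word.rep_eq cp_colors.rep_eq Abs_cperm_inverse biletters_def
      zip_map_fst_snd)

lemma map_fst_biletters [simp]: "map fst (biletters c) = cp_word c"
  and map_snd_biletters [simp]: "map snd (biletters c) = cp_colors c"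
  by (simp_all add: biletters_def length_cp_colors)

lemma length_biletters [simp]: "length (biletters c) = cp_size c"
  by (simp add: biletters_def length_cp_colors cp_size_def)

lemma biletters_inject: "biletters a = biletters b \<longleftrightarrow> a = b"
  by (metis cperm_eqI map_fst_biletters map_snd_biletters)

lemma of_bi_biletters [simp]: "of_bi (biletters c) = c"
  by (simp add: biletters_inject[symmetric] biletters_of_bi is_perm_cp_word)

lemma biletters_empty [simp]: "biletters cp_empty = []"
  by (simp add: biletters_def cp_word.rep_eq cp_empty.rep_eq)

lemma cp_size_empty [simp]: "cp_size cp_empty = 0"
  by (simp flip: length_biletters)

lemma cp_size_0_iff: "cp_size c = 0 \<longleftrightarrow> c = cp_empty"
  using biletters_inject[of c cp_empty] by (simp flip: length_biletters)

lemma set_cp_word: "set (cp_word c) = {1..cp_size c}"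
  using is_perm_cp_word[of c] by (simp add: is_perm_def cp_size_def)

lemma distinct_cp_word: "distinct (cp_word c)"
  using is_perm_cp_word[of c] by (simp add: is_perm_def)

text \<open>The only left factor that a cut after \<open>p\<close> letters allows;
  \<open>suf\<close> gives the matching right factor.\<close>

definition pre :: "nat \<Rightarrow> 'c cperm \<Rightarrow> 'c cperm" where
  "pre p c = of_bi (stdb (take p (biletters c)))"

definition suf :: "nat \<Rightarrow> 'c cperm \<Rightarrow> 'c cperm" where
  "suf p c = of_bi (stdb (drop p (biletters c)))"

lemma biletters_pre: "biletters (pre p c) = stdb (take p (biletters c))"
  unfolding pre_def by (rule biletters_of_bi, rule is_perm_stdb)
    (simp add: take_map[symmetric] distinct_cp_word)

lemma biletters_suf: "biletters (suf p c) = stdb (drop p (biletters c))"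
  unfolding suf_def by (rule biletters_of_bi, rule is_perm_stdb)
    (simp add: drop_map[symmetric] distinct_cp_word)

lemma cp_size_pre [simp]: "cp_size (pre p c) = min p (cp_size c)"
  by (simp add: biletters_pre min.commute flip: length_biletters)

lemma cp_size_suf [simp]: "cp_size (suf p c) = cp_size c - p"
  by (simp add: biletters_suf flip: length_biletters)

text \<open>This and the next two identities describe iterated cuts; associativity of the product
  reduces to them.\<close>

lemma pre_pre: "q \<le> p \<Longrightarrow> pre q (pre p c) = pre q c"
  by (simp add: biletters_inject[symmetric] biletters_pre stdb_stdb_take)

lemma suf_suf: "suf r (suf q c) = suf (q + r) c"
  by (simp add: biletters_inject[symmetric] biletters_suf stdb_stdb_drop add.commute)

lemma suf_pre: "suf q (pre (q + r) c) = pre r (suf q c)"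
  by (simp add: biletters_inject[symmetric] biletters_pre biletters_suf stdb_stdb_take
      stdb_stdb_drop take_drop add.commute)

text \<open>Standardizations are unique, so once the position of the cut is fixed, \<open>c\<close>
  determines both factors.\<close>

lemma mem_cp_convolution_iff:
  "c \<in> cp_convolution a b \<longleftrightarrow>
     cp_size c = cp_size a + cp_size b \<and> a = pre (cp_size a) c \<and> b = suf (cp_size a) c"
proof -
  let ?p = "cp_size a"
  have *: "x = pre ?p c \<longleftrightarrow> cp_word x = map (rank (set (take ?p (cp_word c)))) (take ?p (cp_word c)) \<and>
      cp_colors x = take ?p (cp_colors c)" for x
  proof -
    have "x = pre ?p c \<longleftrightarrow> map fst (biletters x) = map fst (biletters (pre ?p c)) \<and>
      map snd (biletters x) = map snd (biletters (pre ?p c))"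
      by (auto intro: cperm_eqI)
    then show ?thesis
      by (simp only: biletters_pre map_snd_stdb map_fst_stdb take_map[symmetric]
          map_fst_biletters map_snd_biletters)
  qed
  have **: "x = suf ?p c \<longleftrightarrow> cp_word x = map (rank (set (drop ?p (cp_word c)))) (drop ?p (cp_word c)) \<and>
      cp_colors x = drop ?p (cp_colors c)" for x
  proof -
    have "x = suf ?p c \<longleftrightarrow> map fst (biletters x) = map fst (biletters (suf ?p c)) \<and>
      map snd (biletters x) = map snd (biletters (suf ?p c))"
      by (auto intro: cperm_eqI)
    then show ?thesis
      by (simp only: biletters_suf map_snd_stdb map_fst_stdb drop_map[symmetric]
          map_fst_biletters map_snd_biletters)
  qed
  have "cp_size c = cp_size a + cp_size b \<Longrightarrow> cp_colors c = cp_colors a @ cp_colors b \<longleftrightarrow>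
      cp_colors a = take ?p (cp_colors c) \<and> cp_colors b = drop ?p (cp_colors c)"
    by (auto simp: length_cp_colors cp_size_def)
  then show ?thesis
    unfolding *[of a] **[of b] cp_convolution_def convolution_def
    by (auto simp: is_perm_cp_word cp_size_def is_std_iff distinct_cp_word)
qed

section \<open>Product and coproduct in coordinates\<close>

lemma lookup_fq_G: "Poly_Mapping.lookup (fq_G a) b = (if a = b then 1 else 0)"
  by (simp add: fq_G_def lookup_single when_def)

lemma lookup_sum_fq_G:
  "finite A \<Longrightarrow> Poly_Mapping.lookup (\<Sum>a\<in>A. fq_G a) b = (if b \<in> A then 1 else 0)"
  by (simp add: lookup_sum lookup_fq_G)

lemma lin_ext_fq_G [simp]: "lin_ext f (fq_G a) = f a"
  by (simp add: fq_G_def lin_ext_single)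

lemma lin_ext_fq_G_eq [simp]: "lin_ext fq_G x = x"
  using lin_ext_basis[of x] by (simp add: fq_G_def[abs_def])

text \<open>The pairs of basis elements whose product contains \<open>c\<close> are the cuts of
  \<open>c\<close>. They are pairwise distinct, since the size of \<open>pre p c\<close> gives back
  \<open>p\<close>.\<close>

lemma lookup_fq_mult:
  "Poly_Mapping.lookup (x \<bullet>\<^sub>F y) c =
     (\<Sum>p\<le>cp_size c. Poly_Mapping.lookup x (pre p c) * Poly_Mapping.lookup y (suf p c))"
proof -
  let ?h = "\<lambda>(a, b). Poly_Mapping.lookup x a * Poly_Mapping.lookup y b"
  let ?K = "Poly_Mapping.keys x \<times> Poly_Mapping.keys y"
  define M where "M = {(a, b). c \<in> cp_convolution a b}"
  have M: "M = (\<lambda>p. (pre p c, suf p c)) ` {..cp_size c}"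
    by (force simp: M_def mem_cp_convolution_iff image_iff)
  have inj: "inj_on (\<lambda>p. (pre p c, suf p c)) {..cp_size c}"
    by (rule inj_on_inverseI[of _ "\<lambda>(a, b). cp_size a"]) simp
  have "Poly_Mapping.lookup (x \<bullet>\<^sub>F y) c = (\<Sum>(a, b)\<in>?K.
      Poly_Mapping.lookup x a * Poly_Mapping.lookup y b * (if c \<in> cp_convolution a b then 1 else 0))"
    by (simp add: fq_mult_def lookup_sum lookup_fq_G finite_cp_convolution flip: sum.cartesian_product)
  also have "\<dots> = (\<Sum>ab\<in>?K. if ab \<in> M then ?h ab else 0)"
    by (intro sum.cong) (auto simp: M_def)
  also have "\<dots> = sum ?h (?K \<inter> M)"
    by (simp add: sum.inter_restrict)
  also have "\<dots> = sum ?h M"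
    by (rule sum.mono_neutral_left) (auto simp: M in_keys_iff)
  also have "\<dots> = (\<Sum>p\<le>cp_size c. Poly_Mapping.lookup x (pre p c) * Poly_Mapping.lookup y (suf p c))"
    unfolding M by (simp add: sum.reindex[OF inj])
  finally show ?thesis .
qed

section \<open>Bilinearity, unit and associativity of the product\<close>

lemma fq_mult_add_left: "(x + y) \<bullet>\<^sub>F z = x \<bullet>\<^sub>F z + y \<bullet>\<^sub>F z"
  and fq_mult_add_right: "z \<bullet>\<^sub>F (x + y) = z \<bullet>\<^sub>F x + z \<bullet>\<^sub>F y"
  and fq_mult_scale_left: "scale r x \<bullet>\<^sub>F z = scale r (x \<bullet>\<^sub>F z)"
  and fq_mult_scale_right: "z \<bullet>\<^sub>F scale r x = scale r (z \<bullet>\<^sub>F x)"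
  by (rule poly_mapping_eqI, simp add: lookup_fq_mult lookup_add algebra_simps sum.distrib sum_distrib_left)+

lemma fq_mult_zero_left [simp]: "0 \<bullet>\<^sub>F z = 0"
  and fq_mult_zero_right [simp]: "z \<bullet>\<^sub>F 0 = 0"
  by (rule poly_mapping_eqI, simp add: lookup_fq_mult)+

lemma fq_mult_sum_left: "(\<Sum>i\<in>A. f i) \<bullet>\<^sub>F z = (\<Sum>i\<in>A. f i \<bullet>\<^sub>F z)"
  and fq_mult_sum_right: "z \<bullet>\<^sub>F (\<Sum>i\<in>A. f i) = (\<Sum>i\<in>A. z \<bullet>\<^sub>F f i)"
  by (induction A rule: infinite_finite_induct) (simp_all add: fq_mult_add_left fq_mult_add_right)

lemma pre_0 [simp]: "pre 0 c = cp_empty"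
  by (simp flip: cp_size_0_iff)

lemma suf_size [simp]: "suf (cp_size c) c = cp_empty"
  by (simp flip: cp_size_0_iff)

lemma suf_0 [simp]: "suf 0 c = c"
  and pre_size [simp]: "pre (cp_size c) c = c"
  by (simp_all add: pre_def suf_def stdb_is_perm is_perm_cp_word take_all)

lemma pre_eq_empty_iff: "p \<le> cp_size c \<Longrightarrow> pre p c = cp_empty \<longleftrightarrow> p = 0"
  and suf_eq_empty_iff: "p \<le> cp_size c \<Longrightarrow> suf p c = cp_empty \<longleftrightarrow> p = cp_size c"
  by (auto simp flip: cp_size_0_iff)

lemma fq_mult_one_left [simp]: "fq_one \<bullet>\<^sub>F x = x"
  by (rule poly_mapping_eqI)
     (simp add: lookup_fq_mult fq_one_def lookup_fq_G eq_commute[of cp_empty] pre_eq_empty_iff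
       if_distrib[of "\<lambda>x. x * _"] cong: if_cong)

lemma fq_mult_one_right [simp]: "x \<bullet>\<^sub>F fq_one = x"
  by (rule poly_mapping_eqI)
     (simp add: lookup_fq_mult fq_one_def lookup_fq_G eq_commute[of cp_empty] suf_eq_empty_iff
       if_distrib[of "\<lambda>x. _ * x"] cong: if_cong)

text \<open>Two cuts at \<open>q \<le> p\<close> are also given by \<open>q\<close> and the length
  \<open>r = p - q\<close> of the middle piece. The two descriptions belong to the two bracketings
  of a triple product.\<close>

lemma sum_triangle_reindex:
  fixes f :: "nat \<Rightarrow> nat \<Rightarrow> 'a::comm_monoid_add"
  shows "(\<Sum>p\<le>n. \<Sum>q\<le>p. f p q) = (\<Sum>q\<le>n. \<Sum>r\<le>n - q. f (q + r) q)"
  unfolding sum.Sigma[OF finite_atMost ballI[OF finite_atMost]]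
  by (rule sum.reindex_bij_witness[of _ "\<lambda>(q, r). (q + r, q)" "\<lambda>(p, q). (q, p - q)"]) auto

lemma fq_mult_assoc:
  fixes x y z :: "('c::finite, 'k::field) fqsym"
  shows "(x \<bullet>\<^sub>F y) \<bullet>\<^sub>F z = x \<bullet>\<^sub>F (y \<bullet>\<^sub>F z)"
proof (rule poly_mapping_eqI)
  fix c :: "'c cperm"
  let ?n = "cp_size c"
  let ?f = "\<lambda>p q. Poly_Mapping.lookup x (pre q c) * Poly_Mapping.lookup y (suf q (pre p c)) *
      Poly_Mapping.lookup z (suf p c)"
  have "Poly_Mapping.lookup ((x \<bullet>\<^sub>F y) \<bullet>\<^sub>F z) c = (\<Sum>p\<le>?n. \<Sum>q\<le>p. ?f p q)"
    by (simp add: lookup_fq_mult sum_distrib_right pre_pre)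
  also have "\<dots> = (\<Sum>q\<le>?n. \<Sum>r\<le>?n - q. ?f (q + r) q)"
    by (rule sum_triangle_reindex)
  also have "\<dots> = Poly_Mapping.lookup (x \<bullet>\<^sub>F (y \<bullet>\<^sub>F z)) c"
    by (simp add: lookup_fq_mult sum_distrib_left suf_pre suf_suf mult.assoc)
  finally show "Poly_Mapping.lookup ((x \<bullet>\<^sub>F y) \<bullet>\<^sub>F z) c = Poly_Mapping.lookup (x \<bullet>\<^sub>F (y \<bullet>\<^sub>F z)) c" .
qed

section \<open>Cutting colored permutations by value\<close>

definition lo :: "nat \<Rightarrow> 'c cperm \<Rightarrow> 'c cperm" where
  "lo p c = of_bi (filter (\<lambda>x. fst x \<le> p) (biletters c))"

text \<open>The values above \<open>p\<close> form an interval, so a shift by \<open>p\<close> is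
  all the standardization they require; the values kept by \<open>lo\<close> already start at
  1.\<close>

definition hi :: "nat \<Rightarrow> 'c cperm \<Rightarrow> 'c cperm" where
  "hi p c = of_bi (relabel (\<lambda>x. x - p) (filter (\<lambda>x. fst x > p) (biletters c)))"

lemma is_perm_iff: "is_perm s \<longleftrightarrow> distinct s \<and> (\<exists>n. set s = {1..n})"
  unfolding is_perm_def using distinct_card[of s] by (metis card_atLeastAtMost diff_Suc_1)

lemma biletters_lo: "biletters (lo p c) = filter (\<lambda>x. fst x \<le> p) (biletters c)"
  unfolding lo_def
proof (rule biletters_of_bi)
  have *: "map fst (filter (\<lambda>x. fst x \<le> p) (biletters c)) = filter (\<lambda>x. x \<le> p) (cp_word c)"
    by (simp flip: map_fst_biletters add: filter_map o_def)
  have "{x. x \<in> {1..cp_size c} \<and> x \<le> p} = {1..min p (cp_size c)}" by auto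
  then show "is_perm (map fst (filter (\<lambda>x. fst x \<le> p) (biletters c)))"
    unfolding * by (auto simp: is_perm_iff distinct_cp_word set_cp_word)
qed

lemma biletters_hi:
  "biletters (hi p c) = relabel (\<lambda>x. x - p) (filter (\<lambda>x. fst x > p) (biletters c))"
  unfolding hi_def
proof (rule biletters_of_bi)
  have *: "map fst (relabel (\<lambda>x. x - p) (filter (\<lambda>x. fst x > p) (biletters c))) =
      map (\<lambda>x. x - p) (filter (\<lambda>x. x > p) (cp_word c))"
    by (simp flip: map_fst_biletters add: filter_map o_def)
  have "(\<lambda>x. x - p) ` {x. x \<in> {1..cp_size c} \<and> x > p} = {1..cp_size c - p}"
  proof (intro equalityI subsetI)
    fix y assume "y \<in> {1..cp_size c - p}"
    then have "y = y + p - p" "y + p \<in> {x. x \<in> {1..cp_size c} \<and> x > p}" by auto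
    then show "y \<in> (\<lambda>x. x - p) ` {x. x \<in> {1..cp_size c} \<and> x > p}" by (rule image_eqI)
  qed auto
  moreover have "inj_on (\<lambda>x. x - p) {x. x \<in> {1..cp_size c} \<and> x > p}"
    by (auto simp: inj_on_def)
  ultimately show "is_perm (map fst (relabel (\<lambda>x. x - p) (filter (\<lambda>x. fst x > p) (biletters c))))"
    unfolding * by (auto simp: is_perm_iff distinct_map distinct_cp_word set_cp_word)
qed

lemma length_filter_cp_word:
  "length (filter (\<lambda>x. P (fst x)) (biletters c)) = card {x \<in> {1..cp_size c}. P x}"
proof -
  have "length (filter (\<lambda>x. P (fst x)) (biletters c)) = length (filter P (cp_word c))"
    by (simp flip: map_fst_biletters add: filter_map o_def)
  also have "\<dots> = card {x \<in> {1..cp_size c}. P x}"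
    using distinct_card[of "filter P (cp_word c)"] by (simp add: distinct_cp_word set_cp_word)
  finally show ?thesis .
qed

lemma cp_size_lo [simp]: "cp_size (lo p c) = min p (cp_size c)"
proof -
  have "{x \<in> {1..cp_size c}. x \<le> p} = {1..min p (cp_size c)}" by auto
  then show ?thesis
    using length_filter_cp_word[of "\<lambda>x. x \<le> p" c] by (simp flip: length_biletters add: biletters_lo)
qed

lemma cp_size_hi [simp]: "cp_size (hi p c) = cp_size c - p"
proof -
  have "{x \<in> {1..cp_size c}. x > p} = {p<..cp_size c}" by auto
  then show ?thesis
    using length_filter_cp_word[of "\<lambda>x. x > p" c] by (simp flip: length_biletters add: biletters_hi)
qed

text \<open>Together with \<open>hi_hi\<close> and \<open>hi_lo\<close> this is coassociativity, in
  the same shape as \<open>pre_pre\<close>, \<open>suf_suf\<close> and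
  \<open>suf_pre\<close>.\<close>

lemma lo_lo: "q \<le> p \<Longrightarrow> lo q (lo p c) = lo q c"
  by (auto simp: biletters_inject[symmetric] biletters_lo intro!: filter_cong)

lemma hi_hi: "hi r (hi q c) = hi (q + r) c"
  by (auto simp: biletters_inject[symmetric] biletters_hi filter_map o_def intro!: map_cong filter_cong)

lemma hi_lo: "hi q (lo (q + r) c) = lo r (hi q c)"
  by (auto simp: biletters_inject[symmetric] biletters_hi biletters_lo filter_map o_def
      intro!: map_cong filter_cong)

lemma lo_0 [simp]: "lo 0 c = cp_empty"
  by (simp flip: cp_size_0_iff)

lemma hi_size [simp]: "hi (cp_size c) c = cp_empty"
  by (simp flip: cp_size_0_iff)

lemma fst_biletters_bounds: "x \<in> set (biletters c) \<Longrightarrow> 1 \<le> fst x \<and> fst x \<le> cp_size c"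
  using set_cp_word[of c] by (force simp flip: map_fst_biletters)

lemma hi_0 [simp]: "hi 0 c = c"
  and lo_size [simp]: "lo (cp_size c) c = c"
proof -
  have "filter (\<lambda>x. fst x > 0) (biletters c) = biletters c"
    by (rule filter_True) (auto dest: fst_biletters_bounds)
  then show "hi 0 c = c"
    by (simp add: biletters_inject[symmetric] biletters_hi map_prod_def)
  show "lo (cp_size c) c = c"
    by (auto simp: biletters_inject[symmetric] biletters_lo filter_id_conv dest: fst_biletters_bounds)
qed

lemma lo_eq_empty_iff: "p \<le> cp_size c \<Longrightarrow> lo p c = cp_empty \<longleftrightarrow> p = 0"
  and hi_eq_empty_iff: "p \<le> cp_size c \<Longrightarrow> hi p c = cp_empty \<longleftrightarrow> p = cp_size c"
  by (auto simp flip: cp_size_0_iff)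

lemma shifted_shuffle_alt:
  "shifted_shuffle a b =
     {c. biletters c \<in> shuffles (biletters a) (relabel (\<lambda>x. x + cp_size a) (biletters b))}"
  by (simp add: shifted_shuffle_def map_prod_def)

lemma finite_shifted_shuffle: "finite (shifted_shuffle a (b :: 'c::finite cperm))"
  by (rule finite_subset[OF _ finite_cperm_of_size[of "cp_size a + cp_size b"]])
     (auto simp: shifted_shuffle_alt dest: length_shuffles)

text \<open>The letters of \<open>a\<close> are at most \<open>cp_size a\<close> and the shifted
  letters of \<open>b\<close> exceed it, so filtering by this bound recovers both factors.
  Conversely, any word is a shuffle of the two parts of a partition of its letters.\<close>

lemma mem_shifted_shuffle_iff:
  "c \<in> shifted_shuffle a b \<longleftrightarrow> (\<exists>p\<le>cp_size c. a = lo p c \<and> b = hi p c)"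
proof
  assume c: "c \<in> shifted_shuffle a b"
  let ?p = "cp_size a" and ?v = "relabel (\<lambda>x. x + cp_size a) (biletters b)"
  have w: "biletters c \<in> shuffles (biletters a) ?v"
    using c by (simp add: shifted_shuffle_alt)
  have a: "fst x \<le> ?p" if "x \<in> set (biletters a)" for x
    using that by (auto dest: fst_biletters_bounds)
  have v: "fst x > ?p" if "x \<in> set ?v" for x
    using that by (auto dest!: fst_biletters_bounds)
  have "filter (\<lambda>x. fst x \<le> ?p) (biletters c) \<in>
      shuffles (filter (\<lambda>x. fst x \<le> ?p) (biletters a)) (filter (\<lambda>x. fst x \<le> ?p) ?v)"
    using w by (simp flip: filter_shuffles)
  moreover have "filter (\<lambda>x. fst x \<le> ?p) (biletters a) = biletters a"
    using a by (simp add: filter_id_conv)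
  moreover have "filter (\<lambda>x. fst x \<le> ?p) ?v = []"
    using v by (fastforce simp: filter_empty_conv)
  ultimately have "a = lo ?p c"
    by (simp add: biletters_inject[symmetric] biletters_lo)
  moreover have "filter (\<lambda>x. fst x > ?p) (biletters c) \<in>
      shuffles (filter (\<lambda>x. fst x > ?p) (biletters a)) (filter (\<lambda>x. fst x > ?p) ?v)"
    using w by (simp flip: filter_shuffles)
  moreover have "filter (\<lambda>x. fst x > ?p) (biletters a) = []"
    using a by (fastforce simp: filter_empty_conv)
  moreover have "filter (\<lambda>x. fst x > ?p) ?v = ?v"
    using v unfolding filter_id_conv by blast
  ultimately have "b = hi ?p c"
    by (simp add: biletters_inject[symmetric] biletters_hi o_def map_prod_def case_prod_unfold)
  moreover have "?p \<le> cp_size c"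
    using length_shuffles[OF w] by simp
  ultimately show "\<exists>p\<le>cp_size c. a = lo p c \<and> b = hi p c"
    using \<open>a = lo ?p c\<close> by blast
next
  assume "\<exists>p\<le>cp_size c. a = lo p c \<and> b = hi p c"
  then obtain p where p: "p \<le> cp_size c" and ab: "a = lo p c" "b = hi p c" by blast
  have "relabel (\<lambda>x. x + p) (biletters b) = filter (\<lambda>x. \<not> fst x \<le> p) (biletters c)"
    by (auto simp: ab biletters_hi not_le intro!: map_idI)
  then show "c \<in> shifted_shuffle a b"
    using partition_in_shuffles[of "biletters c" "\<lambda>x. fst x \<le> p"] p
    by (simp add: shifted_shuffle_alt ab biletters_lo)
qed

lemma coproduct_lin_ext:
  "(coproduct :: ('c::finite, 'k::field) fqsym \<Rightarrow> _) = lin_ext (\<lambda>c. \<Sum>p\<le>cp_size c. Poly_Mapping.single (lo p c, hi p c) 1)"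
proof -
  have "(\<Sum>(a, b)\<in>{(a, b). c \<in> shifted_shuffle a b}. fq_G a \<otimes>\<^sub>t fq_G b) =
      (\<Sum>p\<le>cp_size c. Poly_Mapping.single (lo p c, hi p c) (1 :: 'k))" for c :: "'c cperm"
  proof -
    have "{(a, b). c \<in> shifted_shuffle a b} = (\<lambda>p. (lo p c, hi p c)) ` {..cp_size c}"
      by (auto simp: mem_shifted_shuffle_iff)
    moreover have "inj_on (\<lambda>p. (lo p c, hi p c)) {..cp_size c}"
      by (rule inj_on_inverseI[of _ "\<lambda>(a, b). cp_size a"]) simp
    ultimately show ?thesis
      by (simp add: sum.reindex tensor_fq_G)
  qed
  then show ?thesis
    by (intro ext) (simp add: coproduct_def lin_ext_def)
qed

text \<open>The transposed view: with the pair \<open>(a, b)\<close> fixed, a coefficient of the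
  coproduct sums over shuffles instead of cuts. This is the form in which compatible words can be
  counted.\<close>

lemma lookup_coproduct:
  fixes x :: "('c::finite, 'k::field) fqsym"
  shows "Poly_Mapping.lookup (coproduct x) (a, b) = (\<Sum>c\<in>shifted_shuffle a b. Poly_Mapping.lookup x c)"
proof -
  have "Poly_Mapping.lookup (coproduct x) (a, b) =
      (\<Sum>c\<in>Poly_Mapping.keys x. if c \<in> shifted_shuffle a b then Poly_Mapping.lookup x c else 0)"
    unfolding coproduct_def lookup_sum
  proof (intro sum.cong refl)
    fix c :: "'c cperm"
    have "(\<Sum>(a, b)\<in>{(a, b). c \<in> shifted_shuffle a b}. fq_G a \<otimes>\<^sub>t fq_G b) =
        (\<Sum>ab\<in>{(a, b). c \<in> shifted_shuffle a b}. Poly_Mapping.single ab (1::'k))"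
      by (intro sum.cong) (auto simp: tensor_fq_G)
    then show "Poly_Mapping.lookup (scale (Poly_Mapping.lookup x c)
        (\<Sum>(a, b)\<in>{(a, b). c \<in> shifted_shuffle a b}. fq_G a \<otimes>\<^sub>t fq_G b)) (a, b) =
        (if c \<in> shifted_shuffle a b then Poly_Mapping.lookup x c else 0)"
      by (simp add: lookup_sum lookup_single when_def finite_unshuffles)
  qed
  also have "\<dots> = (\<Sum>c\<in>Poly_Mapping.keys x \<inter> shifted_shuffle a b. Poly_Mapping.lookup x c)"
    by (simp add: sum.inter_restrict)
  also have "\<dots> = (\<Sum>c\<in>shifted_shuffle a b. Poly_Mapping.lookup x c)"
    by (rule sum.mono_neutral_left) (auto simp: finite_shifted_shuffle in_keys_iff)
  finally show ?thesis .
qed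


section \<open>The antipode\<close>

text \<open>Convolution of endomorphisms given only by their values on the basis, so that inverses
  can be defined by recursion on colored permutations; \<open>conv_unit\<close> is the counit
  followed by the unit.\<close>

definition conv_basis :: "('c::finite cperm \<Rightarrow> ('c, 'k::field) fqsym) \<Rightarrow>
    ('c cperm \<Rightarrow> ('c, 'k) fqsym) \<Rightarrow> 'c cperm \<Rightarrow> ('c, 'k) fqsym" where
  "conv_basis f g c = (\<Sum>p\<le>cp_size c. f (lo p c) \<bullet>\<^sub>F g (hi p c))"

definition conv_unit :: "'c::finite cperm \<Rightarrow> ('c, 'k::field) fqsym" where
  "conv_unit c = (if c = cp_empty then fq_one else 0)"

text \<open>Both sides sum over two value cuts; associativity of the product and the identities for
  iterated cuts match the terms.\<close>

lemma conv_basis_assoc: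
  fixes f g h :: "'c::finite cperm \<Rightarrow> ('c, 'k::field) fqsym"
  shows "conv_basis (conv_basis f g) h = conv_basis f (conv_basis g h)"
proof
  fix c :: "'c cperm"
  let ?n = "cp_size c"
  let ?f = "\<lambda>p q. f (lo q c) \<bullet>\<^sub>F g (hi q (lo p c)) \<bullet>\<^sub>F h (hi p c)"
  have "conv_basis (conv_basis f g) h c = (\<Sum>p\<le>?n. \<Sum>q\<le>p. ?f p q)"
    by (simp add: conv_basis_def fq_mult_sum_left lo_lo)
  also have "\<dots> = (\<Sum>q\<le>?n. \<Sum>r\<le>?n - q. ?f (q + r) q)"
    by (rule sum_triangle_reindex)
  also have "\<dots> = conv_basis f (conv_basis g h) c"
    by (simp add: conv_basis_def fq_mult_sum_right hi_lo hi_hi fq_mult_assoc)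
  finally show "conv_basis (conv_basis f g) h c = conv_basis f (conv_basis g h) c" .
qed

lemma conv_unit_left [simp]: "conv_basis conv_unit f = f"
  by (rule ext)
     (simp add: conv_basis_def conv_unit_def lo_eq_empty_iff if_distrib[of "\<lambda>x. x \<bullet>\<^sub>F _"] cong: if_cong)

lemma conv_unit_right [simp]: "conv_basis f conv_unit = f"
  by (rule ext)
     (simp add: conv_basis_def conv_unit_def hi_eq_empty_iff if_distrib[of "\<lambda>x. _ \<bullet>\<^sub>F x"] cong: if_cong)

text \<open>The equation \<open>conv_basis antipode_left fq_G = conv_unit\<close> solved for its
  term at \<open>p = cp_size c\<close>, where \<open>hi p c\<close> is empty; the other terms
  involve only \<open>lo p c\<close> of smaller size.\<close>

function antipode_left :: "'c::finite cperm \<Rightarrow> ('c, 'k::field) fqsym" where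
  "antipode_left c = (if c = cp_empty then fq_one else
     - (\<Sum>p<cp_size c. antipode_left (lo p c) \<bullet>\<^sub>F fq_G (hi p c)))"
  by auto
termination by (relation "Wellfounded.measure cp_size") auto

text \<open>The mirrored equation, solved for its term at \<open>p = 0\<close>, where
  \<open>lo p c\<close> is empty.\<close>

function antipode_right :: "'c::finite cperm \<Rightarrow> ('c, 'k::field) fqsym" where
  "antipode_right c = (if c = cp_empty then fq_one else
     - (\<Sum>p\<in>{1..cp_size c}. fq_G (lo p c) \<bullet>\<^sub>F antipode_right (hi p c)))"
  by auto
termination by (relation "Wellfounded.measure cp_size") (auto simp: cp_size_0_iff[symmetric])

declare antipode_left.simps [simp del] antipode_right.simps [simp del]

lemma antipode_left: "conv_basis antipode_left fq_G = conv_unit"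
proof
  fix c :: "'a cperm"
  show "conv_basis antipode_left fq_G c = (conv_unit c :: ('a, 'b) fqsym)"
  proof (cases "c = cp_empty")
    case True
    then show ?thesis
      by (simp add: conv_basis_def conv_unit_def antipode_left.simps flip: fq_one_def)
  next
    case False
    then show ?thesis
      by (simp add: conv_basis_def conv_unit_def lessThan_Suc_atMost[symmetric]
          antipode_left.simps[of c] flip: fq_one_def)
  qed
qed

lemma antipode_right: "conv_basis fq_G antipode_right = conv_unit"
proof
  fix c :: "'a cperm"
  show "conv_basis fq_G antipode_right c = (conv_unit c :: ('a, 'b) fqsym)"
  proof (cases "c = cp_empty")
    case True
    then show ?thesis
      by (simp add: conv_basis_def conv_unit_def antipode_right.simps flip: fq_one_def)
  next
    case False
    have "{..cp_size c} = insert 0 {1..cp_size c}" by auto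
    with False show ?thesis
      by (simp add: conv_basis_def conv_unit_def antipode_right.simps[of c] flip: fq_one_def)
  qed
qed

text \<open>In the monoid given by \<open>conv_basis\<close> and \<open>conv_unit\<close>, a left
  and a right inverse of the same element agree.\<close>

lemma antipode_left_eq_right: "antipode_left = antipode_right"
  by (metis antipode_left antipode_right conv_basis_assoc conv_unit_left conv_unit_right)

definition antipode :: "('c::finite, 'k::field) fqsym \<Rightarrow> ('c, 'k) fqsym" where
  "antipode = lin_ext antipode_left"

text \<open>The map \<open>\<mu> \<circ> (f \<otimes> g)\<close> without the coproduct, so that it
  can also be evaluated on tensors of elements outside the basis, such as products of
  generators.\<close>

definition conv_pairing :: "(('c::finite, 'k::field) fqsym \<Rightarrow> ('c, 'k) fqsym) \<Rightarrow>
    (('c, 'k) fqsym \<Rightarrow> ('c, 'k) fqsym) \<Rightarrow> ('c cperm \<times> 'c cperm \<Rightarrow>\<^sub>0 'k) \<Rightarrow> ('c, 'k) fqsym" where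
  "conv_pairing f g = lin_ext (\<lambda>(a, b). f (fq_G a) \<bullet>\<^sub>F g (fq_G b))"

lemma endo_convolution_eq: "endo_convolution f g x = conv_pairing f g (coproduct x)"
  by (simp add: endo_convolution_def conv_pairing_def lin_ext_def case_prod_unfold)

lemma endo_convolution_lin_ext:
  "endo_convolution f g x = lin_ext (conv_basis (\<lambda>a. f (fq_G a)) (\<lambda>b. g (fq_G b))) x"
  by (simp add: endo_convolution_eq conv_pairing_def coproduct_lin_ext lin_ext_lin_ext lin_ext_sum
      lin_ext_single conv_basis_def[abs_def])

lemma lin_ext_conv_unit: "lin_ext conv_unit x = scale (counit x) fq_one"
  by (rule poly_mapping_eqI)
     (auto simp: lookup_lin_ext conv_unit_def counit_def if_distrib[of "\<lambda>x. Poly_Mapping.lookup x _"]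
       if_distrib[of "\<lambda>x. _ * x"] sum.delta in_keys_iff cong: if_cong)

lemma is_antipode_antipode: "is_antipode antipode"
  by (simp add: is_antipode_def antipode_def linear_lin_ext endo_convolution_lin_ext antipode_left
      antipode_right[folded antipode_left_eq_right] lin_ext_conv_unit)

text \<open>The pairing sees its maps only on basis vectors; for linear extensions, bilinearity of
  the product carries the formula to all pure tensors.\<close>

lemma conv_pairing_tensor:
  "conv_pairing (lin_ext f) (lin_ext g) (x \<otimes>\<^sub>t y) = lin_ext f x \<bullet>\<^sub>F lin_ext g y"
proof -
  have "lin_ext f x \<bullet>\<^sub>F lin_ext g y = (\<Sum>a\<in>Poly_Mapping.keys x. \<Sum>b\<in>Poly_Mapping.keys y.
      scale (Poly_Mapping.lookup x a * Poly_Mapping.lookup y b) (f a \<bullet>\<^sub>F g b))"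
    by (simp only: lin_ext_def fq_mult_sum_left)
       (simp add: fq_mult_sum_right fq_mult_scale_left fq_mult_scale_right mult.commute)
  then show ?thesis
    by (simp add: conv_pairing_def tensor_def lin_ext_sum lin_ext_single)
qed

section \<open>Words compatible with a vector composition\<close>

definition block :: "nat ^ 'c::finite \<Rightarrow> (nat \<times> 'c) list \<Rightarrow> bool" where
  "block n w \<longleftrightarrow> sorted_wrt (<) (map fst w) \<and> (\<forall>i. count_list (map snd w) i = n $ i)"

text \<open>\<open>take\<close> may return fewer than \<open>weight n\<close> letters at the end of
  a word, but then \<open>block n\<close> fails, since the content fixes the length. So the columns
  determine the cuts.\<close>

fun compat :: "(nat ^ 'c::finite) list \<Rightarrow> (nat \<times> 'c) list \<Rightarrow> bool" where
  "compat [] w \<longleftrightarrow> w = []"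
| "compat (n # I) w \<longleftrightarrow> block n (take (weight n) w) \<and> compat I (drop (weight n) w)"

lemma weight_eq_0_iff [simp]: "weight n = 0 \<longleftrightarrow> n = 0"
  by (auto simp: weight_def vec_eq_iff)

lemma weight_0 [simp]: "weight 0 = 0"
  by simp

lemma weight_add: "weight (m + n) = weight m + weight n"
  by (simp add: weight_def sum.distrib)

lemma block_length: "block n w \<Longrightarrow> length w = weight n"
  using sum_count_set[of "map snd w" UNIV] by (simp add: block_def weight_def)

lemma block_unique: "block m w \<Longrightarrow> block n w \<Longrightarrow> m = n"
  by (simp add: block_def vec_eq_iff)

lemma block_relabel:
  assumes "strict_mono_on (fst ` set w) f"
  shows "block n (relabel f w) \<longleftrightarrow> block n w"
proof -
  have "sorted_wrt (<) (map f (map fst w)) \<longleftrightarrow> sorted_wrt (<) (map fst w)"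
    unfolding sorted_wrt_map[of _ f]
    using strict_mono_on_less[OF assms] by (auto simp: sorted_wrt_map sorted_wrt_iff_nth_less)
  then show ?thesis by (simp add: block_def del: map_map)
qed

text \<open>Product coefficients involve standardized factors; this invariance lets compatibility be
  read on the original letters.\<close>

lemma compat_relabel:
  "strict_mono_on (fst ` set w) f \<Longrightarrow> compat I (relabel f w) \<longleftrightarrow> compat I w"
proof (induction I arbitrary: w)
  case (Cons n I)
  have "strict_mono_on (fst ` set (take (weight n) w)) f" "strict_mono_on (fst ` set (drop (weight n) w)) f"
    by (rule monotone_on_subset[OF Cons.prems], auto dest: in_set_takeD in_set_dropD)+
  then show ?case
    using Cons.IH unfolding compat.simps take_map drop_map by (simp only: block_relabel)
qed simp

lemma compat_stdb: "compat I (stdb w) \<longleftrightarrow> compat I w"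
  and block_stdb: "block n (stdb w) \<longleftrightarrow> block n w"
  by (simp_all add: stdb_def compat_relabel block_relabel strict_mono_on_rank)

text \<open>The only increasing permutation is the identity, and the color content determines its
  size.\<close>

lemma lookup_fq_S: "Poly_Mapping.lookup (fq_S n) c = (if block n (biletters c) then 1 else 0)"
proof -
  have "cp_word c = [1..<Suc (weight n)] \<and> (\<forall>i. count_list (cp_colors c) i = n $ i) \<longleftrightarrow>
      block n (biletters c)" (is "?L \<longleftrightarrow> ?R")
  proof
    assume ?R
    then have "cp_word c = [1..<Suc (weight n)]"
      using block_length[OF \<open>?R\<close>]
      by (intro strict_sorted_equal) (auto simp: block_def set_cp_word simp del: upt_Suc)
    then show ?L using \<open>?R\<close> by (simp add: block_def)
  qed (simp add: block_def del: upt_Suc)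
  then show ?thesis
    unfolding fq_S_def lookup_sum_fq_G[OF finite_fq_S_index] mem_Collect_eq by (simp only:)
qed

text \<open>Of all cuts of \<open>c\<close>, only the one after \<open>weight n\<close> letters can
  contribute to the product with \<open>fq_S n\<close>, because a block has the length of its
  content. So no coefficient exceeds 1.\<close>

lemma lookup_fq_S_comp:
  "Poly_Mapping.lookup (fq_S_comp I :: ('c::finite, 'k::field) fqsym) c =
    (if compat I (biletters c) then 1 else 0)"
proof (induction I arbitrary: c)
  case Nil
  have "biletters c = [] \<longleftrightarrow> c = cp_empty"
    using biletters_inject[of c cp_empty] by simp
  then show ?case by (auto simp: fq_S_comp_def fq_one_def lookup_fq_G)
next
  case (Cons n I)
  let ?w = "biletters c"
  have "Poly_Mapping.lookup (fq_S_comp (n # I) :: ('c, 'k) fqsym) c =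
      (\<Sum>p\<le>cp_size c. if p = weight n then if compat (n # I) ?w then 1 else 0 else 0)"
  proof -
    have *: "(fq_S_comp (n # I) :: ('c, 'k) fqsym) = fq_S n \<bullet>\<^sub>F fq_S_comp I"
      by (simp add: fq_S_comp_def)
    show ?thesis
      unfolding * lookup_fq_mult Cons.IH lookup_fq_S
      by (intro sum.cong refl)
         (auto simp: biletters_pre biletters_suf block_stdb compat_stdb dest!: block_length)
  qed
  also have "\<dots> = (if compat (n # I) ?w then 1 else 0)"
    by (auto dest!: block_length)
  finally show ?case .
qed

lemma fq_S_comp_Nil [simp]: "fq_S_comp [] = fq_one"
  and fq_S_comp_Cons: "fq_S_comp (n # I) = fq_S n \<bullet>\<^sub>F fq_S_comp I"
  by (simp_all add: fq_S_comp_def)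

lemma fq_S_comp_append: "fq_S_comp (I @ J) = fq_S_comp I \<bullet>\<^sub>F fq_S_comp J"
  by (induction I) (simp_all add: fq_S_comp_Cons fq_mult_assoc)

lemma fq_S_comp_filter: "fq_S_comp (filter (\<lambda>n. n \<noteq> 0) I) = fq_S_comp I"
  by (induction I) (simp_all add: fq_S_comp_Cons fq_S_zero)

lemma range_fq_S_comp: "range fq_S_comp = fq_S_comp ` vector_compositions"
proof -
  have "fq_S_comp (filter (\<lambda>n. n \<noteq> 0) I) \<in> fq_S_comp ` vector_compositions" for I :: "(nat ^ 'a) list"
    by (rule imageI) (simp add: vector_compositions_def)
  then show ?thesis by (auto simp: fq_S_comp_filter)
qed

section \<open>The generated subalgebra as a linear span\<close>

lemma subalgebra_Sym: "subalgebra Sym"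
  unfolding Sym_def by (rule hull_in) (auto simp: subalgebra_def intro: pm.subspace_Inter)

lemma subspace_Sym: "pm.subspace Sym"
  and one_in_Sym: "fq_one \<in> Sym"
  and mult_in_Sym: "x \<in> Sym \<Longrightarrow> y \<in> Sym \<Longrightarrow> x \<bullet>\<^sub>F y \<in> Sym"
  by (insert subalgebra_Sym[unfolded subalgebra_def]) blast+

lemma fq_S_in_Sym: "fq_S n \<in> Sym"
  unfolding Sym_def by (rule hull_inc) simp

lemma fq_S_comp_in_Sym: "fq_S_comp I \<in> Sym"
proof (induction I)
  case Nil
  then show ?case by (simp add: one_in_Sym)
next
  case (Cons n I)
  then show ?case by (simp add: mult_in_Sym fq_S_comp_Cons fq_S_in_Sym)
qed

text \<open>Provides the subspace condition for inductions over a span in which the property says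
  that a linear image lies in \<open>V\<close>.\<close>

lemma subspace_vimage_add_scale:
  assumes "pm.subspace V" "\<And>x y. f (x + y) = f x + f y" "\<And>c x. f (scale c x) = scale c (f x)"
  shows "pm.subspace {x. f x \<in> V}"
proof -
  have "f 0 = 0" using assms(3)[of 0 0] by simp
  with assms show ?thesis by (simp add: pm.subspace_def)
qed

text \<open>Concatenating the lists of columns multiplies the corresponding elements, so by
  bilinearity the span is closed under products.\<close>

lemma Sym_eq_span: "(Sym :: ('c::finite, 'k::field) fqsym set) = pm.span (range fq_S_comp)"
proof
  show "pm.span (range fq_S_comp) \<subseteq> Sym"
    by (rule pm.span_minimal) (auto simp: fq_S_comp_in_Sym subspace_Sym)
  let ?V = "pm.span (range fq_S_comp) :: ('c, 'k) fqsym set"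
  have "x \<bullet>\<^sub>F y \<in> ?V" if "x \<in> ?V" "y \<in> ?V" for x y
    using \<open>x \<in> ?V\<close>
  proof (induction rule: pm.span_induct[where P = "\<lambda>x. x \<bullet>\<^sub>F y \<in> ?V"])
    case base
    show ?case
      by (intro subspace_vimage_add_scale pm.subspace_span) (simp_all add: fq_mult_add_left fq_mult_scale_left)
  next
    case (step x)
    then obtain I where x: "x = fq_S_comp I" by blast
    show ?case using \<open>y \<in> ?V\<close>
    proof (induction rule: pm.span_induct[where P = "\<lambda>y. x \<bullet>\<^sub>F y \<in> ?V"])
      case base
      show ?case
        by (intro subspace_vimage_add_scale pm.subspace_span) (simp_all add: fq_mult_add_right fq_mult_scale_right)
    next
      case (step y)
      then show ?case by (auto simp: x fq_S_comp_append[symmetric] intro: pm.span_base)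
    qed
  qed
  moreover have "fq_one \<in> ?V"
    by (metis fq_S_comp_Nil pm.span_base rangeI)
  ultimately have "subalgebra ?V"
    by (simp add: subalgebra_def pm.subspace_span)
  moreover have "fq_S n \<in> ?V" for n
    by (rule pm.span_base, rule range_eqI[of _ _ "[n]"]) (simp add: fq_S_comp_Cons)
  ultimately show "Sym \<subseteq> ?V"
    unfolding Sym_def by (intro hull_minimal) auto
qed

lemma Sym_induct [consumes 1, case_names subspace S]:
  assumes "x \<in> Sym" "pm.subspace {x. P x}" "\<And>I. P (fq_S_comp I)"
  shows "P x"
  using assms(1) unfolding Sym_eq_span
  by (rule pm.span_induct) (use assms in auto)


section \<open>Linear independence\<close>

text \<open>Independence of a family, not of a set: a repeated vector counts as a relation. It
  therefore contains the injectivity of the indexing as well.\<close>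

definition lin_indep_family :: "('a \<Rightarrow> 'b \<Rightarrow>\<^sub>0 'k::field) \<Rightarrow> 'a set \<Rightarrow> bool" where
  "lin_indep_family f A \<longleftrightarrow> (\<forall>p. Poly_Mapping.keys p \<subseteq> A \<longrightarrow> lin_ext f p = 0 \<longrightarrow> p = 0)"

lemma lin_indep_family_reindex:
  assumes "lin_indep_family f A" "inj_on g B" "g ` B \<subseteq> A" "\<And>b. b \<in> B \<Longrightarrow> h b = f (g b)"
  shows "lin_indep_family h B"
  unfolding lin_indep_family_def
proof (intro allI impI)
  fix p assume p: "Poly_Mapping.keys p \<subseteq> B" "lin_ext h p = 0"
  \<comment> \<open>The coefficients of \<open>p\<close> pushed forward along \<open>g\<close>;
    injectivity of \<open>g\<close> keeps them separate.\<close>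
  define q where "q = lin_ext (\<lambda>b. Poly_Mapping.single (g b) 1) p"
  have q: "Poly_Mapping.lookup q a = (\<Sum>b\<in>Poly_Mapping.keys p. if g b = a then Poly_Mapping.lookup p b else 0)" for a
    unfolding q_def lookup_lin_ext by (intro sum.cong refl) (simp add: lookup_single when_def)
  have "Poly_Mapping.keys q \<subseteq> A"
  proof
    fix a assume "a \<in> Poly_Mapping.keys q"
    then have nz: "Poly_Mapping.lookup q a \<noteq> 0" by (simp add: in_keys_iff)
    have "\<exists>b\<in>Poly_Mapping.keys p. g b = a"
    proof (rule ccontr)
      assume "\<not> (\<exists>b\<in>Poly_Mapping.keys p. g b = a)"
      then have "Poly_Mapping.lookup q a = 0" unfolding q by (intro sum.neutral) auto
      with nz show False by simp
    qed
    then show "a \<in> A" using p assms(3) by auto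
  qed
  moreover have "lin_ext f q = lin_ext h p"
    unfolding q_def lin_ext_lin_ext using p assms(4)
    by (intro lin_ext_cong) (auto simp: lin_ext_single)
  ultimately have "q = 0"
    using assms(1) p by (simp add: lin_indep_family_def)
  show "p = 0"
  proof (rule poly_mapping_eqI)
    fix b
    show "Poly_Mapping.lookup p b = Poly_Mapping.lookup 0 b"
    proof (cases "b \<in> Poly_Mapping.keys p")
      case True
      have "Poly_Mapping.lookup q (g b) =
          (\<Sum>b'\<in>Poly_Mapping.keys p. if b' = b then Poly_Mapping.lookup p b' else 0)"
        unfolding q using True p assms(2) by (intro sum.cong refl if_cong) (auto dest: inj_onD)
      then show ?thesis using True \<open>q = 0\<close> by simp
    qed (simp add: in_keys_iff)
  qed
qed

lemma lin_indep_family_imp_inj_on: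
  fixes f :: "'a \<Rightarrow> 'b \<Rightarrow>\<^sub>0 'k::field"
  assumes "lin_indep_family f A"
  shows "inj_on f A"
proof (rule inj_onI)
  fix a b assume ab: "a \<in> A" "b \<in> A" "f a = f b"
  let ?p = "Poly_Mapping.single a 1 - Poly_Mapping.single b (1 :: 'k)"
  have "lin_ext f ?p = 0"
    by (simp add: lin_ext_diff lin_ext_single ab)
  moreover have "Poly_Mapping.keys ?p \<subseteq> A"
    using ab by (auto simp: in_keys_iff lookup_minus lookup_single when_def split: if_splits)
  ultimately have "?p = 0"
    using assms unfolding lin_indep_family_def by blast
  then have "Poly_Mapping.lookup (Poly_Mapping.single a (1 :: 'k)) a =
      Poly_Mapping.lookup (Poly_Mapping.single b (1 :: 'k)) a" by simp
  then show "a = b" by (simp add: lookup_single when_def split: if_splits)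
qed

lemma lin_indep_family_imp_independent:
  fixes f :: "'a \<Rightarrow> 'b \<Rightarrow>\<^sub>0 'k::field"
  assumes "lin_indep_family f A"
  shows "pm.independent (f ` A)"
  unfolding pm.independent_explicit_module
proof (intro allI impI)
  fix t and u :: "('b \<Rightarrow>\<^sub>0 'k) \<Rightarrow> 'k" and v
  assume t: "finite t" "t \<subseteq> f ` A" "(\<Sum>v\<in>t. scale (u v) v) = 0" "v \<in> t"
  define p where "p = (\<Sum>v\<in>t. Poly_Mapping.single v (u v))"
  have lookup_p: "Poly_Mapping.lookup p v = (if v \<in> t then u v else 0)" for v
    by (simp add: p_def lookup_sum lookup_single when_def t)
  \<comment> \<open>Reindexing along a choice of preimages yields the identity family on the image,
    whose relations are those of the set.\<close>
  have "lin_indep_family (\<lambda>v. v) (f ` A)"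
    by (rule lin_indep_family_reindex[OF assms inj_on_inv_into[OF subset_refl]])
       (auto simp: inv_into_into f_inv_into_f)
  moreover have "Poly_Mapping.keys p \<subseteq> f ` A"
    using t by (auto simp: in_keys_iff lookup_p split: if_splits)
  moreover have "lin_ext (\<lambda>v. v) p = 0"
    using t by (simp add: p_def lin_ext_sum lin_ext_single)
  ultimately have "p = 0" by (simp add: lin_indep_family_def)
  then show "u v = 0" using lookup_p[of v] t by simp
qed

lemma lin_ext_image_eq_span:
  fixes f :: "'a \<Rightarrow> 'b \<Rightarrow>\<^sub>0 'k::field"
  shows "lin_ext f ` {p. Poly_Mapping.keys p \<subseteq> B} = pm.span (f ` B)"
proof
  show "lin_ext f ` {p. Poly_Mapping.keys p \<subseteq> B} \<subseteq> pm.span (f ` B)"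
  proof safe
    fix p :: "'a \<Rightarrow>\<^sub>0 'k" assume "Poly_Mapping.keys p \<subseteq> B"
    then show "lin_ext f p \<in> pm.span (f ` B)"
      unfolding lin_ext_def by (intro pm.span_sum pm.span_scale) (rule pm.span_base, blast)
  qed
  show "pm.span (f ` B) \<subseteq> lin_ext f ` {p. Poly_Mapping.keys p \<subseteq> B}"
  proof (rule pm.span_minimal)
    show "f ` B \<subseteq> lin_ext f ` {p. Poly_Mapping.keys p \<subseteq> B}"
    proof safe
      fix b assume "b \<in> B"
      then show "f b \<in> lin_ext f ` {p. Poly_Mapping.keys p \<subseteq> B}"
        by (intro image_eqI[of _ _ "Poly_Mapping.single b 1"]) (simp_all add: lin_ext_single)
    qed
    have add: "Poly_Mapping.keys (p + q) \<subseteq> B"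
      if "Poly_Mapping.keys p \<subseteq> B" "Poly_Mapping.keys q \<subseteq> B" for p q :: "'a \<Rightarrow>\<^sub>0 'k"
      using that Poly_Mapping.keys_add[of p q] by blast
    have scale: "Poly_Mapping.keys (scale c p) \<subseteq> B" if "Poly_Mapping.keys p \<subseteq> B" for c and p :: "'a \<Rightarrow>\<^sub>0 'k"
      using that by (auto simp: in_keys_iff)
    show "pm.subspace (lin_ext f ` {p. Poly_Mapping.keys p \<subseteq> B})"
      unfolding pm.subspace_def
    proof (intro conjI ballI allI)
      show "0 \<in> lin_ext f ` {p. Poly_Mapping.keys p \<subseteq> B}"
        by (rule image_eqI[of _ _ 0]) simp_all
    next
      fix x y
      assume "x \<in> lin_ext f ` {p. Poly_Mapping.keys p \<subseteq> B}" "y \<in> lin_ext f ` {p. Poly_Mapping.keys p \<subseteq> B}"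
      then obtain p q where "x = lin_ext f p" "y = lin_ext f q"
        "Poly_Mapping.keys p \<subseteq> B" "Poly_Mapping.keys q \<subseteq> B" by blast
      then show "x + y \<in> lin_ext f ` {p. Poly_Mapping.keys p \<subseteq> B}"
        by (intro image_eqI[of _ _ "p + q"]) (simp_all add: lin_ext_add add)
    next
      fix c x
      assume "x \<in> lin_ext f ` {p. Poly_Mapping.keys p \<subseteq> B}"
      then obtain p where "x = lin_ext f p" "Poly_Mapping.keys p \<subseteq> B" by blast
      then show "scale c x \<in> lin_ext f ` {p. Poly_Mapping.keys p \<subseteq> B}"
        by (intro image_eqI[of _ _ "scale c p"]) (simp_all add: lin_ext_scale scale)
    qed
  qed
qed

section \<open>Descents and extremal words\<close>

fun descents :: "nat list \<Rightarrow> nat" where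
  "descents (x # y # w) = (if x > y then 1 else 0) + descents (y # w)"
| "descents w = 0"

lemma descents_sorted: "sorted_wrt (<) u \<Longrightarrow> descents u = 0"
  by (induction u rule: descents.induct) simp_all

lemma descents_append_le:
  "sorted_wrt (<) u \<Longrightarrow> descents (u @ v) \<le> Suc (descents v)"
proof (induction u rule: descents.induct)
  case ("2_2" x)
  show ?case by (cases v) simp_all
qed simp_all

lemma descents_append_less:
  "sorted_wrt (<) u \<Longrightarrow> \<forall>x\<in>set u. \<forall>y\<in>set v. y < x \<Longrightarrow> u \<noteq> [] \<Longrightarrow> v \<noteq> [] \<Longrightarrow>
    descents (u @ v) = Suc (descents v)"
proof (induction u rule: descents.induct)
  case ("2_2" x)
  then show ?case by (cases v) simp_all
qed simp_all

text \<open>A descent can only occur where one block meets the next, and there are at most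
  \<open>length I - 1\<close> such places.\<close>

lemma compat_descents: "compat I w \<Longrightarrow> w \<noteq> [] \<Longrightarrow> descents (map fst w) < length I"
proof (induction I arbitrary: w)
  case (Cons n I)
  let ?u = "take (weight n) w" and ?v = "drop (weight n) w"
  have u: "sorted_wrt (<) (map fst ?u)" using Cons.prems by (simp add: block_def)
  have w: "map fst w = map fst ?u @ map fst ?v" by (simp flip: map_append)
  show ?case
  proof (cases "?v = []")
    case True
    then have "map fst w = map fst ?u" using w by simp
    then show ?thesis using descents_sorted[OF u] by simp
  next
    case False
    then have "descents (map fst ?v) < length I" using Cons by simp
    then show ?thesis using descents_append_le[OF u, of "map fst ?v"] by (simp only: w) simp
  qed
qed simp

lemma ex_word_of_content: "\<exists>u :: 'c::finite list. \<forall>i. count_list u i = f i"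
proof -
  have "\<exists>u. \<forall>i. count_list u i = (if i \<in> A then f i else 0)" if "finite A" for A :: "'c set"
    using that
  proof induction
    case empty
    show ?case by (rule exI[of _ "[]"]) simp
  next
    case (insert a A)
    then obtain u where u: "\<And>i. count_list u i = (if i \<in> A then f i else 0)" by blast
    have "count_list (replicate k a) i = (if i = a then k else 0)" for k i
      by (induction k) auto
    then have "\<forall>i. count_list (replicate (f a) a @ u) i = (if i \<in> insert a A then f i else 0)"
      using insert.hyps by (auto simp: u)
    then show ?case by blast
  qed
  from this[of UNIV] show ?thesis by simp
qed

text \<open>The word attached to \<open>I\<close> has descents exactly at the block boundaries, so every vector
  composition compatible with it refines \<open>I\<close>: this gives unitriangularity with respect to length.\<close>

lemma ex_extremal_word:
  assumes "0 \<notin> set I"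
  shows "\<exists>w. is_perm (map fst w) \<and> compat I w \<and> (I = [] \<longleftrightarrow> w = []) \<and>
    descents (map fst w) = length I - 1 \<and>
    (\<forall>J. 0 \<notin> set J \<longrightarrow> length J \<le> length I \<longrightarrow> compat J w \<longrightarrow> J = I)"
  using assms
proof (induction I)
  case Nil
  show ?case by (rule exI[of _ "[]"]) (simp add: is_perm_def)
next
  case (Cons n I)
  then obtain w where w: "is_perm (map fst w)" "compat I w" "I = [] \<longleftrightarrow> w = []"
      "descents (map fst w) = length I - 1"
    and uniq: "\<And>J. 0 \<notin> set J \<Longrightarrow> length J \<le> length I \<Longrightarrow> compat J w \<Longrightarrow> J = I"
    by auto
  obtain cs where cs: "\<And>i. count_list cs i = n $ i"
    using ex_word_of_content[of "($) n"] by blast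
  have lcs: "length cs = weight n"
    using sum_count_set[of cs UNIV] by (simp add: cs weight_def)
  \<comment> \<open>The new block takes the values just above those of \<open>w\<close>. Placed in
    front, it makes its junction with \<open>w\<close> a descent.\<close>
  define b where "b = zip [Suc (length w)..<Suc (length w + weight n)] cs"
  have lb: "length b = weight n" and fb: "map fst b = [Suc (length w)..<Suc (length w + weight n)]"
    by (simp_all add: b_def lcs del: upt_Suc)
  have n: "weight n > 0" using Cons.prems by (simp add: zero_less_iff_neq_zero)
  have blk: "block n b"
    unfolding block_def fb by (simp add: b_def lcs cs del: upt_Suc)
  have sw: "fst ` set w = {1..length w}" using w(1) by (simp add: is_perm_def)
  have sb: "fst ` set b = {Suc (length w)..length w + weight n}"
    using arg_cong[OF fb, of set] by (simp add: atLeastLessThanSuc_atLeastAtMost del: upt_Suc)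
  have gt: "fst y < fst x" if "x \<in> set b" "y \<in> set w" for x y
  proof -
    have "fst x \<in> fst ` set b" "fst y \<in> fst ` set w" using that by auto
    then show ?thesis unfolding sw sb by simp
  qed
  \<comment> \<open>\<open>k = 0\<close> counts the descents of the whole word;
    \<open>k = weight j\<close> serves the case in which \<open>J\<close> starts with a column
    \<open>j\<close> of smaller weight.\<close>
  have desc: "descents (map fst (drop k b @ w)) = length I" if "k < weight n" for k
  proof -
    have srt: "sorted_wrt (<) (map fst (drop k b))"
      unfolding drop_map[symmetric] fb by (simp add: drop_upt del: upt_Suc)
    have ne: "map fst (drop k b) \<noteq> []" using that lb by simp
    show ?thesis
    proof (cases "w = []")
      case True
      then show ?thesis using w(3) descents_sorted[OF srt] by simp
    next
      case False
      have "\<forall>x\<in>set (map fst (drop k b)). \<forall>y\<in>set (map fst w). y < x"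
        using gt by (auto dest!: in_set_dropD)
      then have "descents (map fst (drop k b) @ map fst w) = Suc (descents (map fst w))"
        using False ne by (intro descents_append_less[OF srt]) auto
      then show ?thesis using w(3,4) False by (simp add: neq_Nil_conv)
    qed
  qed
  show ?case
  proof (intro exI[of _ "b @ w"] conjI allI impI)
    have "fst ` set b \<inter> fst ` set w = {}" unfolding sw sb by auto
    moreover have "fst ` set b \<union> fst ` set w = {1..length w + weight n}" unfolding sw sb by auto
    moreover have "distinct (map fst b)" unfolding fb by simp
    ultimately show "is_perm (map fst (b @ w))"
      using w(1) by (simp add: is_perm_def lb add.commute)
    show "compat (n # I) (b @ w)" using blk w(2) lb by simp
    show "(n # I = []) = (b @ w = [])" using lb n by auto
    show "descents (map fst (b @ w)) = length (n # I) - 1"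
      using desc[of 0] n by simp
    fix J assume J: "0 \<notin> set J" "length J \<le> length (n # I)" "compat J (b @ w)"
    have "b @ w \<noteq> []" using lb n by auto
    then obtain j J' where J': "J = j # J'" using J(3) by (cases J) simp_all
    have bj: "block j (take (weight j) (b @ w))" and cj: "compat J' (drop (weight j) (b @ w))"
      using J(3) J' by auto
    \<comment> \<open>If \<open>j\<close> is too light, the remaining word still has
      \<open>length I\<close> descents, so \<open>J'\<close> would have more than
      \<open>length I\<close> columns. If \<open>j\<close> is too heavy, its block contains the
      descent at the junction. Equal weights force equal contents, and induction applies to
      \<open>J'\<close>.\<close>
    consider "weight j < weight n" | "weight j = weight n" | "weight j > weight n" by linarith
    then show "J = n # I"
    proof cases
      case 1
      then have "compat J' (drop (weight j) b @ w)" using cj lb by simp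
      from compat_descents[OF this] show ?thesis
        using desc[OF 1] J(2) J' 1 lb by simp
    next
      case 2
      then have "block j b" "compat J' w" using bj cj lb by simp_all
      then show ?thesis using block_unique[OF _ blk] uniq[of J'] J(1,2) J' by simp
    next
      case 3
      have "length (take (weight j - weight n) w) > 0" using block_length[OF bj] 3 lb by simp
      then obtain y where y: "y \<in> set (take (weight j - weight n) w)"
        using nth_mem by blast
      obtain x where x: "x \<in> set b" using lb n nth_mem[of 0 b] by metis
      have "take (weight j) (b @ w) = b @ take (weight j - weight n) w" using 3 lb by simp
      then have "sorted_wrt (<) (map fst b @ map fst (take (weight j - weight n) w))"
        using bj unfolding block_def by (metis map_append)
      then have "\<forall>a\<in>fst ` set b. \<forall>c\<in>fst ` set (take (weight j - weight n) w). a < c"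
        unfolding sorted_wrt_append set_map by simp
      then have "fst x < fst y" using imageI[OF x, of fst] imageI[OF y, of fst] by blast
      moreover have "fst y < fst x" by (rule gt[OF x in_set_takeD[OF y]])
      ultimately show ?thesis by simp
    qed
  qed
qed

text \<open>In a nontrivial relation choose \<open>I\<close> of maximal length in the support. At
  the extremal word of \<open>I\<close> every other term vanishes, so the coefficient of
  \<open>I\<close> would be zero.\<close>

lemma lin_indep_family_fq_S_comp:
  "lin_indep_family (fq_S_comp :: _ \<Rightarrow> ('c::finite, 'k::field) fqsym) vector_compositions"
  unfolding lin_indep_family_def
proof (intro allI impI, rule ccontr)
  fix p :: "(nat ^ 'c) list \<Rightarrow>\<^sub>0 'k"
  assume p: "Poly_Mapping.keys p \<subseteq> vector_compositions"
    "lin_ext fq_S_comp p = (0 :: ('c, 'k) fqsym)" "p \<noteq> 0"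
  then have "Poly_Mapping.keys p \<noteq> {}" by simp
  then have "Max (length ` Poly_Mapping.keys p) \<in> length ` Poly_Mapping.keys p" by simp
  then obtain I where I: "I \<in> Poly_Mapping.keys p" "length I = Max (length ` Poly_Mapping.keys p)"
    by auto
  have max: "length J \<le> length I" if "J \<in> Poly_Mapping.keys p" for J
    unfolding I(2) using that by simp
  have nz: "0 \<notin> set J" if "J \<in> Poly_Mapping.keys p" for J
    using that p(1) by (auto simp: vector_compositions_def)
  from ex_extremal_word[OF nz[OF I(1)]] obtain w where w: "is_perm (map fst w)" "compat I w"
    and uniq: "\<And>J. J \<in> Poly_Mapping.keys p \<Longrightarrow> compat J w \<Longrightarrow> J = I"
    using nz max by blast
  have "0 = Poly_Mapping.lookup (lin_ext fq_S_comp p :: ('c, 'k) fqsym) (of_bi w)"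
    using p(2) by simp
  also have "\<dots> = (\<Sum>J\<in>Poly_Mapping.keys p. if J = I then Poly_Mapping.lookup p I else 0)"
    unfolding lookup_lin_ext lookup_fq_S_comp biletters_of_bi[OF w(1)]
    using w(2) by (intro sum.cong refl) (auto dest: uniq)
  also have "\<dots> = Poly_Mapping.lookup p I" using I(1) by simp
  finally show False using I(1) by (simp add: in_keys_iff)
qed

section \<open>The coproduct on products of generators\<close>

text \<open>Decompositions of the matrix \<open>I\<close> into a sum of two matrices. Both keep the
  number of columns of \<open>I\<close>, zero columns included, so that they stay aligned with the
  blocks.\<close>

fun splits :: "(nat ^ 'c::finite) list \<Rightarrow> ((nat ^ 'c) list \<times> (nat ^ 'c) list) set" where
  "splits [] = {([], [])}"
| "splits (n # I) = (\<lambda>((j, k), (J, K)). (j # J, k # K)) ` ({(j, k). j + k = n} \<times> splits I)"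

lemma finite_splits: "finite (splits I)"
  by (induction I) (simp_all add: finite_sum_decompositions)

lemma sum_splits_Cons:
  "(\<Sum>x\<in>splits (n # I). f x) =
     (\<Sum>(j, k)\<in>{(j, k). j + k = n}. \<Sum>(J, K)\<in>splits I. f (j # J, k # K))"
proof -
  have "inj_on (\<lambda>((j, k), (J, K)). (j # J, k # K)) ({(j, k). j + k = n} \<times> splits I)"
    by (auto simp: inj_on_def)
  then show ?thesis
    by (simp add: sum.reindex sum.cartesian_product case_prod_unfold)
qed

lemma swap_splits: "(J, K) \<in> splits I \<Longrightarrow> (K, J) \<in> splits I"
proof (induction I arbitrary: J K)
  case (Cons n I)
  then obtain j k J' K' where *: "j + k = n" "(J', K') \<in> splits I" "J = j # J'" "K = k # K'"
    by auto
  then have "k + j = n" "(K', J') \<in> splits I" using Cons.IH by (simp_all add: add.commute)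
  then show ?case using * by force
qed simp

lemma splits_zero_right: "(I, replicate (length I) 0) \<in> splits I"
proof (induction I)
  case (Cons n I)
  then show ?case by (force intro!: image_eqI[of _ _ "((n, 0), (I, replicate (length I) 0))"])
qed simp

lemma weight_splits:
  "(J, K) \<in> splits I \<Longrightarrow> sum_list (map weight I) = sum_list (map weight J) + sum_list (map weight K)"
  by (induction I arbitrary: J K) (auto simp: weight_add)

text \<open>Singles out the one pair that carries the antipode of \<open>fq_S_comp I\<close> itself:
  in every other pair \<open>K\<close> has positive weight.\<close>

lemma splits_weight_0:
  "(J, K) \<in> splits I \<Longrightarrow> sum_list (map weight K) = 0 \<Longrightarrow> J = I \<and> K = replicate (length I) 0"
  by (induction I arbitrary: J K) auto

text \<open>When \<open>u\<close> has only letters \<open>\<le> p\<close> and \<open>v\<close> only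
  larger ones, these are the shuffles of \<open>u\<close> and \<open>v\<close> that are compatible
  with \<open>I\<close>; the threshold \<open>p\<close> makes the two parts recoverable.\<close>

definition unshuffled :: "nat \<Rightarrow> (nat ^ 'c::finite) list \<Rightarrow> (nat \<times> 'c) list \<Rightarrow> (nat \<times> 'c) list \<Rightarrow>
    (nat \<times> 'c) list set" where
  "unshuffled p I u v =
     {w. filter (\<lambda>x. fst x \<le> p) w = u \<and> filter (\<lambda>x. \<not> fst x \<le> p) w = v \<and> compat I w}"

lemma finite_unshuffled: "finite (unshuffled p I u v)"
  by (rule finite_subset[OF _ finite_shuffles[of u v]])
     (auto simp: unshuffled_def partition_in_shuffles)

definition content :: "(nat \<times> 'c) list \<Rightarrow> nat ^ 'c::finite" where
  "content w = (\<chi> i. count_list (map snd w) i)"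

lemma block_iff: "block n w \<longleftrightarrow> sorted_wrt (<) (map fst w) \<and> content w = n"
  by (auto simp: block_def content_def vec_eq_iff)

lemma content_append: "content (a @ b) = content a + content b"
  by (simp add: content_def vec_eq_iff)

lemma weight_content: "weight (content w) = length w"
  using sum_count_set[of "map snd w" UNIV] by (simp add: content_def weight_def)

text \<open>In an increasing word the small letters come before the large ones, so a block is
  determined by its two parts.\<close>

lemma sorted_partition:
  "sorted_wrt (<) (map fst w) \<Longrightarrow> filter (\<lambda>x. fst x \<le> p) w @ filter (\<lambda>x. \<not> fst x \<le> p) w = w"
  for p :: nat
proof (induction w)
  case (Cons x w)
  show ?case
  proof (cases "fst x \<le> p")
    case False
    then have "filter (\<lambda>x. fst x \<le> p) w = []" "filter (\<lambda>x. \<not> fst x \<le> p) w = w"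
      using Cons.prems by (auto simp: filter_empty_conv filter_id_conv)
    then show ?thesis using False by simp
  qed (use Cons in simp)
qed simp

text \<open>The small letters of the first block form a prefix of \<open>u\<close> and its large
  letters a prefix of \<open>v\<close>. The contents \<open>j\<close> and \<open>k\<close> of these
  prefixes add up to \<open>n\<close> and fix their lengths; what remains is an unshuffling problem
  for \<open>I\<close>.\<close>

lemma card_unshuffled_Cons:
  fixes n :: "nat ^ 'c::finite"
  assumes u: "\<And>x. x \<in> set u \<Longrightarrow> fst x \<le> p" and v: "\<And>x. x \<in> set v \<Longrightarrow> p < fst x"
  shows "card (unshuffled p (n # I) u v) =
    (\<Sum>(j, k)\<in>{(j, k). j + k = n}. if block j (take (weight j) u) \<and> block k (take (weight k) v)
       then card (unshuffled p I (drop (weight j) u) (drop (weight k) v)) else 0)"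
proof -
  define M where
    "M = {(j, k). j + k = n \<and> block j (take (weight j) u) \<and> block k (take (weight k) v)}"
  define T where "T = (\<lambda>(j :: nat ^ 'c, k :: nat ^ 'c). unshuffled p I (drop (weight j) u) (drop (weight k) v))"
  \<comment> \<open>\<open>f\<close> glues the two prefixes into the first block, small letters in
    front; \<open>g\<close> recovers the contents of the prefixes and the rest of the word.\<close>
  define f where "f = (\<lambda>((j :: nat ^ 'c, k :: nat ^ 'c), w). take (weight j) u @ take (weight k) v @ w)"
  define g where "g = (\<lambda>w :: (nat \<times> 'c) list. ((content (filter (\<lambda>x. fst x \<le> p) (take (weight n) w)),
      content (filter (\<lambda>x. \<not> fst x \<le> p) (take (weight n) w))), drop (weight n) w))"
  have M_sub: "M \<subseteq> {(j, k). j + k = n}" by (auto simp: M_def)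
  then have finM: "finite M" using finite_sum_decompositions by (rule finite_subset)
  have fwd: "f x \<in> unshuffled p (n # I) u v \<and> g (f x) = x" if x: "x \<in> Sigma M T" for x
  proof -
    obtain j k w where xe: "x = ((j, k), w)" by (metis surj_pair)
    define a b where "a = take (weight j) u" and "b = take (weight k) v"
    have jk: "j + k = n" "block j a" "block k b"
      and w: "w \<in> unshuffled p I (drop (weight j) u) (drop (weight k) v)"
      using x by (auto simp: xe M_def T_def a_def b_def)
    have a: "fst y \<le> p" if "y \<in> set a" for y using that unfolding a_def by (intro u) (rule in_set_takeD)
    have b: "p < fst y" if "y \<in> set b" for y using that unfolding b_def by (intro v) (rule in_set_takeD)
    have fa: "filter (\<lambda>x. fst x \<le> p) a = a" "filter (\<lambda>x. \<not> fst x \<le> p) a = []"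
      by (simp_all add: filter_id_conv filter_empty_conv a)
    have fb: "filter (\<lambda>x. \<not> fst x \<le> p) b = b" "filter (\<lambda>x. fst x \<le> p) b = []"
      by (simp_all add: filter_id_conv filter_empty_conv not_le b)
    have fx: "f x = (a @ b) @ w" by (simp add: f_def xe a_def b_def)
    have len: "length (a @ b) = weight n"
      using block_length[OF jk(2)] block_length[OF jk(3)] by (simp flip: jk(1) add: weight_add)
    have td: "take (weight n) (f x) = a @ b" "drop (weight n) (f x) = w"
      unfolding fx len[symmetric] by simp_all
    have cont: "content a = j" "content b = k" using jk by (simp_all add: block_iff)
    have "sorted_wrt (<) (map fst (a @ b))"
      using jk a b by (fastforce simp: block_iff sorted_wrt_append)
    then have "block n (a @ b)" using cont jk(1) by (simp add: block_iff content_append)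
    moreover have "filter (\<lambda>x. fst x \<le> p) (f x) = u" "filter (\<lambda>x. \<not> fst x \<le> p) (f x) = v"
      using w unfolding fx filter_append fa fb by (simp_all add: unshuffled_def a_def b_def)
    moreover have "compat I w" using w by (simp add: unshuffled_def)
    ultimately have "f x \<in> unshuffled p (n # I) u v"
      unfolding unshuffled_def mem_Collect_eq compat.simps td by blast
    moreover have "g (f x) = x" unfolding g_def td filter_append fa fb by (simp add: cont xe)
    ultimately show ?thesis by blast
  qed
  have bwd: "g w \<in> Sigma M T \<and> f (g w) = w" if w: "w \<in> unshuffled p (n # I) u v" for w
  proof -
    define w1 w2 where "w1 = take (weight n) w" and "w2 = drop (weight n) w"
    define a b where "a = filter (\<lambda>x. fst x \<le> p) w1" and "b = filter (\<lambda>x. \<not> fst x \<le> p) w1"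
    have ww: "w = w1 @ w2" by (simp add: w1_def w2_def)
    have blk: "block n w1" and cpt: "compat I w2" and uv: "u = a @ filter (\<lambda>x. fst x \<le> p) w2"
        "v = b @ filter (\<lambda>x. \<not> fst x \<le> p) w2"
      using w unfolding unshuffled_def a_def b_def filter_append[symmetric] ww[symmetric]
      by (simp_all add: w1_def w2_def)
    have ab: "a @ b = w1"
      using blk unfolding a_def b_def by (intro sorted_partition) (simp add: block_iff)
    have "sorted_wrt (<) (map fst a @ map fst b)" "content a + content b = n"
      using blk by (simp_all add: block_iff flip: ab content_append)
    then have jk: "block (content a) a" "block (content b) b" "content a + content b = n"
      by (simp_all add: block_iff sorted_wrt_append)
    have g: "g w = ((content a, content b), w2)"
      by (simp add: g_def a_def b_def w1_def w2_def)
    have "g w \<in> Sigma M T"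
      using jk cpt by (simp add: g M_def T_def weight_content uv unshuffled_def)
    moreover have "f (g w) = w"
      unfolding g by (simp add: f_def weight_content uv ww flip: ab)
    ultimately show ?thesis by blast
  qed
  have "bij_betw f (Sigma M T) (unshuffled p (n # I) u v)"
    by (rule bij_betw_byWitness[where f' = g]) (use fwd bwd in blast)+
  then have "card (unshuffled p (n # I) u v) = card (Sigma M T)"
    by (simp add: bij_betw_same_card)
  also have "\<dots> = (\<Sum>m\<in>M. card (T m))"
    by (rule card_SigmaI[OF finM]) (auto simp: T_def finite_unshuffled)
  also have "\<dots> = (\<Sum>m\<in>{(j, k). j + k = n}. if m \<in> M then card (T m) else 0)"
    using M_sub finite_sum_decompositions[of n] by (simp add: sum.inter_restrict[symmetric] Int_absorb1)
  also have "\<dots> = (\<Sum>(j, k)\<in>{(j, k). j + k = n}. if block j (take (weight j) u) \<and> block k (take (weight k) v)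
       then card (unshuffled p I (drop (weight j) u) (drop (weight k) v)) else 0)"
    by (intro sum.cong refl) (auto simp: M_def T_def split: if_splits)
  finally show ?thesis .
qed

lemma card_unshuffled:
  assumes "\<And>x. x \<in> set u \<Longrightarrow> fst x \<le> p" "\<And>x. x \<in> set v \<Longrightarrow> p < fst x"
  shows "card (unshuffled p I u v) = (\<Sum>(J, K)\<in>splits I. if compat J u \<and> compat K v then 1 else 0)"
  using assms
proof (induction I arbitrary: u v)
  case Nil
  have "unshuffled p [] u v = (if u = [] \<and> v = [] then {[]} else {})"
    by (auto simp: unshuffled_def)
  then show ?case by simp
next
  case (Cons n I)
  have IH: "card (unshuffled p I (drop j u) (drop k v)) =
      (\<Sum>(J, K)\<in>splits I. if compat J (drop j u) \<and> compat K (drop k v) then 1 else 0)" for j k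
    by (rule Cons.IH) (auto dest!: in_set_dropD intro: Cons.prems)
  have "card (unshuffled p (n # I) u v) =
    (\<Sum>(j, k)\<in>{(j, k). j + k = n}. if block j (take (weight j) u) \<and> block k (take (weight k) v)
       then card (unshuffled p I (drop (weight j) u) (drop (weight k) v)) else 0)"
    using Cons.prems by (rule card_unshuffled_Cons)
  also have "\<dots> = (\<Sum>x\<in>splits (n # I). case x of (J, K) \<Rightarrow> if compat J u \<and> compat K v then 1 else 0)"
    unfolding sum_splits_Cons
  proof (intro sum.cong refl, clarify)
    fix j k
    show "(if block j (take (weight j) u) \<and> block k (take (weight k) v)
        then card (unshuffled p I (drop (weight j) u) (drop (weight k) v)) else 0) =
      (\<Sum>(J, K)\<in>splits I. if compat (j # J) u \<and> compat (k # K) v then 1 else 0)"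
    proof (cases "block j (take (weight j) u) \<and> block k (take (weight k) v)")
      case True
      then show ?thesis by (simp add: IH)
    next
      case False
      then show ?thesis by (auto intro!: sum.neutral[symmetric])
    qed
  qed
  finally show ?case .
qed

text \<open>At \<open>(a, b)\<close> the left coefficient counts the shuffles of \<open>a\<close>
  with the shifted \<open>b\<close> that are compatible with \<open>I\<close>, and the right one
  counts the splits compatible with both factors. \<open>card_unshuffled\<close> equates the two
  numbers, and \<open>of_nat\<close> carries this to any field.\<close>

lemma coproduct_fq_S_comp:
  "coproduct (fq_S_comp I :: ('c::finite, 'k::field) fqsym) =
     (\<Sum>(J, K)\<in>splits I. fq_S_comp J \<otimes>\<^sub>t fq_S_comp K)"
proof (rule poly_mapping_eqI)
  fix ab :: "'c cperm \<times> 'c cperm"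
  obtain a b where ab: "ab = (a, b)" by (cases ab)
  let ?p = "cp_size a" and ?u = "biletters a"
  let ?v = "relabel (\<lambda>x. x + cp_size a) (biletters b)"
  have u: "fst x \<le> ?p" if "x \<in> set ?u" for x
    using that by (auto dest: fst_biletters_bounds)
  have v: "?p < fst x" if "x \<in> set ?v" for x
    using that by (auto dest!: fst_biletters_bounds)
  have "strict_mono_on A (\<lambda>x. x + ?p)" for A by (auto simp: strict_mono_on_def)
  then have compat_v: "compat K ?v \<longleftrightarrow> compat K (biletters b)" for K
    by (rule compat_relabel)
  have shuffle_iff: "w \<in> shuffles ?u ?v \<longleftrightarrow>
      filter (\<lambda>x. fst x \<le> ?p) w = ?u \<and> filter (\<lambda>x. \<not> fst x \<le> ?p) w = ?v" for w
  proof
    assume w: "w \<in> shuffles ?u ?v"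
    have "set ?u \<inter> set ?v = {}" using u v by fastforce
    note filter_shuffles_disjoint1[OF this w]
    moreover have "x \<in> set ?u \<longleftrightarrow> fst x \<le> ?p" if "x \<in> set w" for x
      using that u[of x] v[of x] set_shuffles[OF w] by (metis Un_iff not_le)
    ultimately show "filter (\<lambda>x. fst x \<le> ?p) w = ?u \<and> filter (\<lambda>x. \<not> fst x \<le> ?p) w = ?v"
      by (metis (mono_tags, lifting) filter_cong)
  qed (metis partition_in_shuffles)
  \<comment> \<open>The letters of such a shuffle fill an interval from 1, so every word in
    \<open>unshuffled\<close> comes from a colored permutation and \<open>biletters\<close> is
    onto.\<close>
  have perm: "is_perm (map fst w)" if w: "w \<in> shuffles ?u ?v" for w
  proof -
    have "fst ` set ?u = {1..?p}"
      using set_cp_word[of a] by (simp flip: map_fst_biletters)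
    moreover have "fst ` set ?v = (\<lambda>x. x + ?p) ` set (map fst (biletters b))"
      by (simp add: image_image del: map_fst_biletters)
    then have "fst ` set ?v = (\<lambda>x. x + ?p) ` {1..cp_size b}"
      by (simp add: set_cp_word)
    ultimately have "set (map fst w) = {1..?p} \<union> {1 + ?p..cp_size b + ?p}"
      using set_shuffles[OF w] by (simp add: image_Un)
    also have "\<dots> = {1..?p + cp_size b}" by auto
    finally have "set (map fst w) = {1..?p + cp_size b}" .
    moreover have "length w = ?p + cp_size b" using length_shuffles[OF w] by simp
    ultimately show ?thesis
      by (simp add: is_perm_def card_distinct)
  qed
  have "bij_betw biletters {c \<in> shifted_shuffle a b. compat I (biletters c)} (unshuffled ?p I ?u ?v)"
  proof (rule bij_betwI')
    fix w assume "w \<in> unshuffled ?p I ?u ?v"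
    then have "w \<in> shuffles ?u ?v" "compat I w" by (simp_all add: unshuffled_def shuffle_iff)
    then show "\<exists>c\<in>{c \<in> shifted_shuffle a b. compat I (biletters c)}. w = biletters c"
      by (intro bexI[of _ "of_bi w"]) (simp_all add: biletters_of_bi perm shifted_shuffle_alt)
  qed (auto simp: biletters_inject unshuffled_def shuffle_iff shifted_shuffle_alt)
  then have card: "card {c \<in> shifted_shuffle a b. compat I (biletters c)} = card (unshuffled ?p I ?u ?v)"
    by (rule bij_betw_same_card)
  have card': "card (unshuffled ?p I ?u ?v) =
      (\<Sum>(J, K)\<in>splits I. if compat J ?u \<and> compat K ?v then 1 else 0)"
    using u v by (rule card_unshuffled)
  have "Poly_Mapping.lookup (coproduct (fq_S_comp I :: ('c, 'k) fqsym)) ab =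
      of_nat (card {c \<in> shifted_shuffle a b. compat I (biletters c)})"
    by (simp add: ab lookup_coproduct lookup_fq_S_comp finite_shifted_shuffle flip: sum.inter_filter)
  also have "\<dots> = (\<Sum>(J, K)\<in>splits I. if compat J ?u \<and> compat K (biletters b) then 1 else 0)"
    unfolding card card' compat_v of_nat_sum by (intro sum.cong) auto
  also have "\<dots> = Poly_Mapping.lookup (\<Sum>(J, K)\<in>splits I. fq_S_comp J \<otimes>\<^sub>t fq_S_comp K :: _ \<Rightarrow>\<^sub>0 'k) ab"
    by (auto simp: ab lookup_sum lookup_fq_S_comp case_prod_unfold intro!: sum.cong)
  finally show "Poly_Mapping.lookup (coproduct (fq_S_comp I :: ('c, 'k) fqsym)) ab =
      Poly_Mapping.lookup (\<Sum>(J, K)\<in>splits I. fq_S_comp J \<otimes>\<^sub>t fq_S_comp K :: _ \<Rightarrow>\<^sub>0 'k) ab" .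
qed

lemma fq_S_comp_single [simp]: "fq_S_comp [n] = fq_S n"
  by (simp add: fq_S_comp_Cons)

lemma coproduct_fq_S:
  "coproduct (fq_S n :: ('c::finite, 'k::field) fqsym) =
     (\<Sum>(i, j)\<in>{(i, j). i + j = n}. fq_S i \<otimes>\<^sub>t fq_S j)"
  using coproduct_fq_S_comp[of "[n]", where 'k = 'k] by (simp add: sum_splits_Cons del: splits.simps(2))

lemma coproduct_add: "coproduct (x + y) = coproduct x + coproduct y"
  and coproduct_scale: "coproduct (scale c x) = scale c (coproduct x)"
  by (simp_all add: coproduct_lin_ext lin_ext_add lin_ext_scale)

lemma coproduct_Sym: "x \<in> Sym \<Longrightarrow> coproduct x \<in> tensor_subspace Sym Sym"
proof (induction rule: Sym_induct)
  case subspace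
  show ?case unfolding tensor_subspace_def
    by (intro subspace_vimage_add_scale pm.subspace_span) (simp_all add: coproduct_add coproduct_scale)
next
  case (S I)
  show ?case unfolding coproduct_fq_S_comp tensor_subspace_def case_prod_unfold
    by (intro pm.span_sum pm.span_base) (use fq_S_comp_in_Sym in blast)
qed

section \<open>Cocommutativity\<close>

lemma lookup_twist: "Poly_Mapping.lookup (twist t) (b, a) = Poly_Mapping.lookup t (a, b)"
  by (simp add: twist_def map_key.rep_eq)

text \<open>The coproduct formula is symmetric because \<open>J + K = I\<close> is symmetric in
  \<open>J\<close> and \<open>K\<close>; linearity extends this from the products to their
  span.\<close>

lemma cocommutative_on_Sym: "cocommutative_on (Sym :: ('c::finite, 'k::field) fqsym set)"
  unfolding cocommutative_on_def
proof
  fix x :: "('c, 'k) fqsym"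
  assume "x \<in> Sym"
  then show "twist (coproduct x) = coproduct x"
  proof (induction rule: Sym_induct)
    case subspace
    \<comment> \<open>The locus of equality is written as the preimage of \<open>{0}\<close> under
      the difference of the two linear maps.\<close>
    have "pm.subspace {x :: ('c, 'k) fqsym. twist (coproduct x) - coproduct x \<in> {0}}"
    proof (rule subspace_vimage_add_scale)
      fix x y :: "('c, 'k) fqsym" and c
      show "twist (coproduct (x + y)) - coproduct (x + y) =
          twist (coproduct x) - coproduct x + (twist (coproduct y) - coproduct y)"
        by (rule poly_mapping_eqI)
           (auto simp: coproduct_add lookup_twist lookup_minus lookup_add)
      show "twist (coproduct (scale c x)) - coproduct (scale c x) =
          scale c (twist (coproduct x) - coproduct x)"
        by (rule poly_mapping_eqI)
           (auto simp: coproduct_scale lookup_twist lookup_minus algebra_simps)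
    qed (rule pm.subspace_single_0)
    then show ?case by simp
  next
    case (S I)
    show ?case
    proof (rule poly_mapping_eqI, clarify)
      fix a b
      have "Poly_Mapping.lookup (twist (coproduct (fq_S_comp I :: ('c, 'k) fqsym))) (a, b) =
          (\<Sum>(J, K)\<in>splits I. Poly_Mapping.lookup (fq_S_comp J) b * Poly_Mapping.lookup (fq_S_comp K) a)"
        by (simp add: lookup_twist coproduct_fq_S_comp lookup_sum case_prod_unfold)
      also have "\<dots> = (\<Sum>(J, K)\<in>splits I. Poly_Mapping.lookup (fq_S_comp J) a * Poly_Mapping.lookup (fq_S_comp K) b)"
        by (rule sum.reindex_bij_witness[of _ prod.swap prod.swap]) (auto intro: swap_splits)
      also have "\<dots> = Poly_Mapping.lookup (coproduct (fq_S_comp I :: ('c, 'k) fqsym)) (a, b)"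
        by (simp add: coproduct_fq_S_comp lookup_sum case_prod_unfold)
      finally show "Poly_Mapping.lookup (twist (coproduct (fq_S_comp I :: ('c, 'k) fqsym))) (a, b) =
        Poly_Mapping.lookup (coproduct (fq_S_comp I)) (a, b)" .
    qed
  qed
qed

section \<open>Stability under the antipode\<close>

lemma fq_S_comp_replicate_0 [simp]: "fq_S_comp (replicate m 0) = fq_one"
  by (induction m) (simp_all add: fq_S_comp_Cons fq_S_zero)

text \<open>The antipode axiom expressed through tensors of products of generators instead of basis
  tensors, so that every right factor lies in \<open>Sym\<close>.\<close>

lemma antipode_convolution_fq_S_comp:
  fixes I :: "(nat ^ 'c::finite) list"
  defines "S \<equiv> fq_S_comp :: _ \<Rightarrow> ('c, 'k::field) fqsym"
  shows "(\<Sum>(J, K)\<in>splits I. antipode (S J) \<bullet>\<^sub>F S K) = scale (counit (S I)) fq_one"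
  unfolding S_def
proof -
  \<comment> \<open>\<open>conv_pairing_tensor\<close> speaks about linear extensions, so the
    identity is presented as one.\<close>
  have id: "lin_ext fq_G = id" by (rule ext) simp
  have "scale (counit (fq_S_comp I :: ('c, 'k) fqsym)) fq_one = conv_pairing antipode id (coproduct (fq_S_comp I))"
    by (simp add: is_antipode_antipode[unfolded is_antipode_def] flip: endo_convolution_eq)
  also have "\<dots> = (\<Sum>(J, K)\<in>splits I. conv_pairing antipode id (fq_S_comp J \<otimes>\<^sub>t fq_S_comp K))"
    by (simp add: coproduct_fq_S_comp conv_pairing_def lin_ext_sum case_prod_unfold)
  also have "\<dots> = (\<Sum>(J, K)\<in>splits I. antipode (fq_S_comp J) \<bullet>\<^sub>F fq_S_comp K)"
    unfolding antipode_def id[symmetric] conv_pairing_tensor by simp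
  finally show "(\<Sum>(J, K)\<in>splits I. antipode (fq_S_comp J) \<bullet>\<^sub>F fq_S_comp K) =
      scale (counit (fq_S_comp I :: ('c, 'k) fqsym)) fq_one" by simp
qed

text \<open>Apart from the antipode of \<open>S\<^sup>I\<close> itself, the antipode axiom at \<open>S\<^sup>I\<close> only involves antipodes of
  elements of smaller degree.\<close>

lemma antipode_fq_S_comp_in_Sym: "antipode (fq_S_comp I :: ('c::finite, 'k::field) fqsym) \<in> Sym"
proof (induction "sum_list (map weight I)" arbitrary: I rule: less_induct)
  case less
  let ?e = "(I, replicate (length I) 0)"
  let ?t = "\<lambda>(J, K). antipode (fq_S_comp J) \<bullet>\<^sub>F fq_S_comp K :: ('c, 'k) fqsym"
  \<comment> \<open>Outside \<open>?e\<close> the matrix \<open>K\<close> has positive weight, so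
    \<open>J\<close> has smaller weight than \<open>I\<close> and the induction hypothesis covers
    its antipode.\<close>
  have "?t x \<in> Sym" if x: "x \<in> splits I - {?e}" for x
  proof -
    obtain J K where JK: "x = (J, K)" by (cases x)
    then have "(J, K) \<in> splits I" and ne: "sum_list (map weight K) \<noteq> 0"
      using x splits_weight_0[of J K I] by auto
    from weight_splits[OF this(1)] ne have "sum_list (map weight J) < sum_list (map weight I)"
      by linarith
    then show ?thesis by (simp add: JK less mult_in_Sym fq_S_comp_in_Sym)
  qed
  then have "(\<Sum>x\<in>splits I - {?e}. ?t x) \<in> Sym"
    by (rule pm.subspace_sum[OF subspace_Sym])
  moreover have "antipode (fq_S_comp I) + (\<Sum>x\<in>splits I - {?e}. ?t x) =
      scale (counit (fq_S_comp I :: ('c, 'k) fqsym)) fq_one"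
    using antipode_convolution_fq_S_comp[of I, where 'k = 'k]
      sum.remove[OF finite_splits splits_zero_right, of ?t I] by simp
  then have "antipode (fq_S_comp I) =
      scale (counit (fq_S_comp I :: ('c, 'k) fqsym)) fq_one - (\<Sum>x\<in>splits I - {?e}. ?t x)"
    by (simp add: eq_diff_eq)
  ultimately show ?case
    by (simp add: pm.subspace_diff pm.subspace_scale subspace_Sym one_in_Sym)
qed

lemma hopf_subalgebra_Sym: "hopf_subalgebra (Sym :: ('c::finite, 'k::field) fqsym set)"
  unfolding hopf_subalgebra_def
proof (intro conjI ballI exI[of _ antipode])
  fix x :: "('c, 'k) fqsym"
  assume "x \<in> Sym"
  then show "antipode x \<in> Sym"
  proof (induction rule: Sym_induct)
    case subspace
    show ?case
      by (intro subspace_vimage_add_scale subspace_Sym) (simp_all add: antipode_def lin_ext_add lin_ext_scale)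
  qed (rule antipode_fq_S_comp_in_Sym)
qed (auto simp: subalgebra_Sym coproduct_Sym is_antipode_antipode)

section \<open>Freeness\<close>

lemma fq_word_append:
  "foldr (\<bullet>\<^sub>F) (v @ w) fq_one = foldr (\<bullet>\<^sub>F) v fq_one \<bullet>\<^sub>F foldr (\<bullet>\<^sub>F) w fq_one"
  by (induction v) (simp_all add: fq_mult_assoc)

text \<open>The multiplication of the library is that of the monoid algebra, so multiplicativity on
  the monoid extends bilinearly.\<close>

lemma lin_ext_mult:
  fixes p q :: "'x::monoid_add \<Rightarrow>\<^sub>0 'k::field" and f :: "'x \<Rightarrow> ('c::finite, 'k) fqsym"
  assumes "\<And>v w. f (v + w) = f v \<bullet>\<^sub>F f w"
  shows "lin_ext f (p * q) = lin_ext f p \<bullet>\<^sub>F lin_ext f q"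
proof -
  have expand: "r = (\<Sum>a\<in>Poly_Mapping.keys r. Poly_Mapping.single a (Poly_Mapping.lookup r a))"
    for r :: "'x \<Rightarrow>\<^sub>0 'k"
    by (rule poly_mapping_eqI) (simp add: lookup_sum lookup_single when_def in_keys_iff)
  have "lin_ext f (p * q) = lin_ext f (\<Sum>a\<in>Poly_Mapping.keys p. \<Sum>b\<in>Poly_Mapping.keys q.
      Poly_Mapping.single (a + b) (Poly_Mapping.lookup p a * Poly_Mapping.lookup q b))"
    by (subst expand[of p], subst expand[of q]) (simp add: sum_product mult_single)
  also have "\<dots> = (\<Sum>a\<in>Poly_Mapping.keys p. \<Sum>b\<in>Poly_Mapping.keys q.
      scale (Poly_Mapping.lookup p a * Poly_Mapping.lookup q b) (f a \<bullet>\<^sub>F f b))"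
    by (simp add: lin_ext_sum lin_ext_single assms)
  also have "\<dots> = lin_ext f p \<bullet>\<^sub>F lin_ext f q"
    by (simp only: lin_ext_def fq_mult_sum_left)
       (simp add: fq_mult_sum_right fq_mult_scale_left fq_mult_scale_right mult.commute)
  finally show ?thesis .
qed

text \<open>Vector compositions are the words over the nonzero vectors; this turns the linear basis
  into freeness.\<close>

lemma vector_compositions_eq_lists: "vector_compositions = lists {n. weight n > 0}"
  by (auto simp: vector_compositions_def simp flip: neq0_conv simp del: neq0_conv)

lemma free_over_Sym:
  "free_over (Sym :: ('c::finite, 'k::field) fqsym set) (fq_S ` {n. weight n > 0})"
proof -
  let ?N = "{n :: nat ^ 'c. weight n > 0}"
  let ?X = "fq_S ` ?N :: ('c, 'k) fqsym set"
  define W where "W = (\<lambda>w. foldr (\<bullet>\<^sub>F) w fq_one :: ('c, 'k) fqsym)"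
  \<comment> \<open>The alphabet consists of the elements \<open>fq_S n\<close>, not of their
    indices. \<open>g\<close> chooses an index for every letter, and such a choice is injective on
    words.\<close>
  define g where "g = map (inv_into ?N (fq_S :: _ \<Rightarrow> ('c, 'k) fqsym))"
  have W_map: "W (map fq_S I) = fq_S_comp I" for I
    by (simp add: W_def fq_S_comp_def foldr_map o_def)
  have img: "W ` lists ?X = fq_S_comp ` vector_compositions"
    by (simp add: lists_image image_image W_map vector_compositions_eq_lists)
  have "lin_indep_family W (lists ?X)"
  proof (rule lin_indep_family_reindex[OF lin_indep_family_fq_S_comp])
    show "inj_on g (lists ?X)"
      unfolding g_def by (intro inj_on_mapI inj_on_inv_into) auto
    show "g ` lists ?X \<subseteq> vector_compositions"
      unfolding g_def vector_compositions_eq_lists lists_image[symmetric]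
      by (intro lists_mono image_subsetI) (rule inv_into_into)
    fix w assume "w \<in> lists ?X"
    then have "map fq_S (g w) = w"
      unfolding g_def map_map by (intro map_idI) (auto simp: f_inv_into_f)
    then show "W w = fq_S_comp (g w)" using W_map[of "g w"] by simp
  qed
  note indep = this[unfolded lin_indep_family_def, rule_format]
  have inj: "inj_on (lin_ext W) (free_algebra ?X)"
  proof (rule inj_onI)
    fix p q
    assume pq: "p \<in> free_algebra ?X" "q \<in> free_algebra ?X" "lin_ext W p = lin_ext W q"
    then have "Poly_Mapping.keys (p - q) \<subseteq> lists ?X"
      using keys_diff[of p q] unfolding free_algebra_def by blast
    moreover have "lin_ext W (p - q) = 0" using pq(3) by (simp add: lin_ext_diff)
    ultimately have "p - q = 0" by (rule indep)
    then show "p = q" by simp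
  qed
  have surj: "lin_ext W ` free_algebra ?X = Sym"
    unfolding free_algebra_def lin_ext_image_eq_span img Sym_eq_span range_fq_S_comp ..
  have "W (v + w) = W v \<bullet>\<^sub>F W w" for v w
    unfolding W_def plus_list_def by (rule fq_word_append)
  note mult = lin_ext_mult[of W, OF this]
  have one: "lin_ext W 1 = fq_one"
    unfolding single_one[symmetric] lin_ext_single by (simp add: W_def zero_list_def)
  show ?thesis
    unfolding free_over_def
    by (intro conjI subalgebra_Sym exI[of _ "lin_ext W"] ballI allI bij_betw_imageI inj surj mult one)
       (simp_all add: lin_ext_add lin_ext_scale lin_ext_single, simp_all add: W_def)
qed

text \<open>\<open>pm.independent\<close> concerns a set, so the basis indexed by vector
  compositions is expressed by injectivity of the indexing together with independence and spanning
  of the image.\<close>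

theorem theorem4p1:
  shows "free_over (Sym :: ('c::finite, 'k::field) fqsym set) (fq_S ` {n. weight n > 0}) \<and>
    inj_on (fq_S_comp :: _ \<Rightarrow> ('c, 'k) fqsym) vector_compositions \<and>
    pm.independent (fq_S_comp ` vector_compositions :: ('c, 'k) fqsym set) \<and>
    pm.span (fq_S_comp ` vector_compositions) = (Sym :: ('c, 'k) fqsym set) \<and>
    hopf_subalgebra (Sym :: ('c, 'k) fqsym set) \<and>
    (\<forall>n :: nat ^ 'c. coproduct (fq_S n :: ('c, 'k) fqsym) =
      (\<Sum>(i, j)\<in>{(i, j). i + j = n}. fq_S i \<otimes>\<^sub>t fq_S j)) \<and>
    cocommutative_on (Sym :: ('c, 'k) fqsym set)"
  using lin_indep_family_fq_S_comp[where 'c = 'c and 'k = 'k]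
  by (intro conjI allI free_over_Sym hopf_subalgebra_Sym coproduct_fq_S cocommutative_on_Sym)
     (auto simp: lin_indep_family_imp_inj_on lin_indep_family_imp_independent Sym_eq_span range_fq_S_comp)

end
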